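(* Let $p\ge1$ be a computable real, let $(\ell^p)^\#$ be a computable presentation of $\ell^p$, let $\phi$ be a computable disintegration of $(\ell^p)^\#$, and let $\epsilon:\operatorname{dom}(\phi)\to(0,\infty)$ be lower semicomputable. Then there is a partition $\{C_n\}_{n\in\mathbb{N}}$ of $\operatorname{dom}(\phi)$ into uniformly computable chains such that whenever $\nu\in C_n$ is a nonterminal node of $\operatorname{dom}(\phi)$, $C_n$ contains a child $\nu'$ of $\nu$ with $$\max_\mu\|\phi(\mu)\|_p^p-\|\phi(\nu')\|_p^p<\epsilon(\nu),$$ where $\mu$ ranges over all children of $\nu$ in $\operatorname{dom}(\phi)$.
   Context: $\ell^p$ is the Banach space of $f:\mathbb{N}\to\mathbb{C}$ with $\|f\|_p=(\sum_n|f(n)|^p)^{1/p}<\infty$. Disjointly supported = disjoint sets $\{n:f(n)\ne0\}$. Trees: $\mathbb{N}^*$ is the set of finite sequences of naturals; a child of $\nu$ is a one-element extension; a tree is a prefix-closed $S\subseteq\mathbb{N}^*$; a node is terminal if none of its children is in $S$; a chain is a set of pairwise prefix-comparable nodes. A map $\phi:S\to\ell^p$ is separating if $\phi(\nu),\phi(\nu')$ are disjointly supported for prefix-incomparable $\nu,\nu'$; summative if $\phi(\nu)$ equals the sum of $\phi$ over the children of $\nu$ in $S$ for nonterminal $\nu$; a disintegration if it is injective, separating, summative, never $\mathbf{0}$, with linearly dense range. A presentation of $\ell^p$ is $(\ell^p,R)$ with $R:\mathbb{N}\to\ell^p$ of linearly dense range; rational vectors are $\sum_{j\le M}\alpha_jR(j)$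 with $\alpha_j\in\mathbb{Q}(i)$. It is computable if the norm is a computable map into $\mathbb{C}$ (norms can be computed to arbitrary precision from rational-ball approximations of vectors). A map $\phi$ from a tree $S$ into $(\ell^p)^\#$ is computable if $S$ is c.e. and there is a procedure which, given $\nu\in S$ and $k$, outputs a rational vector within $2^{-k}$ of $\phi(\nu)$. $\epsilon$ is lower semicomputable if $\{(\nu,q)\in\operatorname{dom}(\phi)\times\mathbb{Q}: q<\epsilon(\nu)\}$ is c.e. Chains $C_n$ are uniformly computable if membership $\nu\in C_n$ is decidable uniformly in $n$.
   Formalization: "Uniformly computable chains" is read as: membership of ν in C_n is decidable uniformly in n for nodes ν of dom(φ); decidability over all finite sequences can fail when dom(φ) is only c.e., and follows when dom(φ) is decidable. *)

theory Defs
  imports "HOL-Analysis.Analysis" "HOL-Library.Sublist" "HOL-Library.Nat_Bijection"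
    "HOL-Library.Countable" "HOL-Library.Disjoint_Sets"
begin

section \<open>Partial recursive functions\<close>

text \<open>
  Kleene's partial recursive functions, as unary partial functions on the naturals; several
  arguments are passed through the pairing function \<^const>\<open>prod_encode\<close>. Divergence is
  \<^const>\<open>None\<close>.
\<close>

text \<open>Unbounded search: it diverges if some value before the first zero is undefined.\<close>

definition mu_search :: "(nat \<Rightarrow> nat option) \<Rightarrow> nat option" where
  "mu_search h =
    (if \<exists>k. h k = Some 0 \<and> (\<forall>j<k. \<exists>y. h j = Some (Suc y))
     then Some (LEAST k. h k = Some 0) else None)"

inductive partrec :: "(nat \<Rightarrow> nat option) \<Rightarrow> bool" where
  partrec_zero: "partrec (\<lambda>n. Some 0)"
| partrec_succ: "partrec (\<lambda>n. Some (Suc n))"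
| partrec_left: "partrec (\<lambda>n. Some (fst (prod_decode n)))"
| partrec_right: "partrec (\<lambda>n. Some (snd (prod_decode n)))"
| partrec_pair: "partrec f \<Longrightarrow> partrec g \<Longrightarrow>
    partrec (\<lambda>n. Option.bind (f n) (\<lambda>a. Option.bind (g n) (\<lambda>b. Some (prod_encode (a, b)))))"
| partrec_comp: "partrec f \<Longrightarrow> partrec g \<Longrightarrow> partrec (\<lambda>n. Option.bind (g n) f)"
| partrec_prec: "partrec f \<Longrightarrow> partrec g \<Longrightarrow>
    partrec (\<lambda>n. case prod_decode n of (a, m) \<Rightarrow>
      rec_nat (f a)
        (\<lambda>y r. Option.bind r (\<lambda>i. g (prod_encode (a, prod_encode (y, i))))) m)"
| partrec_mu: "partrec f \<Longrightarrow> partrec (\<lambda>a. mu_search (\<lambda>k. f (prod_encode (a, k))))"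

definition ce_set :: "nat set \<Rightarrow> bool" where
  "ce_set A \<longleftrightarrow> (\<exists>f. partrec f \<and> A = dom f)"

text \<open>Rationals are named by \<^const>\<open>nat_to_rat_surj\<close>; every rational has infinitely many names.\<close>

abbreviation rat_code :: "nat \<Rightarrow> real" where
  "rat_code c \<equiv> of_rat (nat_to_rat_surj c)"

definition gauss_code :: "nat \<Rightarrow> complex" where
  "gauss_code c = (case prod_decode c of (a, b) \<Rightarrow> Complex (rat_code a) (rat_code b))"

definition computable_real :: "real \<Rightarrow> bool" where
  "computable_real x \<longleftrightarrow>
    (\<exists>f. partrec f \<and> (\<forall>k. \<exists>c. f k = Some c \<and> \<bar>x - rat_code c\<bar> < 1 / 2 ^ k))"


section \<open>The space of \<open>p\<close>-summable sequences\<close>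

definition lp :: "real \<Rightarrow> (nat \<Rightarrow> complex) set" where
  "lp p = {f. summable (\<lambda>n. norm (f n) powr p)}"

definition lp_norm :: "real \<Rightarrow> (nat \<Rightarrow> complex) \<Rightarrow> real" where
  "lp_norm p f = (\<Sum>n. norm (f n) powr p) powr (1 / p)"

definition supp :: "(nat \<Rightarrow> complex) \<Rightarrow> nat set" where
  "supp f = {n. f n \<noteq> 0}"

definition linearly_dense :: "real \<Rightarrow> (nat \<Rightarrow> complex) set \<Rightarrow> bool" where
  "linearly_dense p A \<longleftrightarrow>
    (\<forall>f\<in>lp p. \<forall>e>0. \<exists>T a. finite T \<and> T \<subseteq> A \<and>
       lp_norm p (\<lambda>n. f n - (\<Sum>g\<in>T. a g * g n)) < e)"

text \<open>Unordered summation with respect to the norm of the space.\<close>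

definition lp_has_sum :: "real \<Rightarrow> ('i \<Rightarrow> nat \<Rightarrow> complex) \<Rightarrow> (nat \<Rightarrow> complex) \<Rightarrow> 'i set \<Rightarrow> bool" where
  "lp_has_sum p g f I \<longleftrightarrow>
    ((\<lambda>F. lp_norm p (\<lambda>n. f n - (\<Sum>i\<in>F. g i n))) \<longlongrightarrow> 0) (finite_subsets_at_top I)"


section \<open>Trees and disintegrations\<close>

definition is_tree :: "nat list set \<Rightarrow> bool" where
  "is_tree S \<longleftrightarrow> (\<forall>\<nu>\<in>S. \<forall>\<mu>. prefix \<mu> \<nu> \<longrightarrow> \<mu> \<in> S)"

definition children :: "nat list set \<Rightarrow> nat list \<Rightarrow> nat list set" where
  "children S \<nu> = {\<nu> @ [k] | k. \<nu> @ [k] \<in> S}"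

definition terminal :: "nat list set \<Rightarrow> nat list \<Rightarrow> bool" where
  "terminal S \<nu> \<longleftrightarrow> children S \<nu> = {}"

definition is_chain :: "nat list set \<Rightarrow> bool" where
  "is_chain C \<longleftrightarrow> (\<forall>\<mu>\<in>C. \<forall>\<nu>\<in>C. prefix \<mu> \<nu> \<or> prefix \<nu> \<mu>)"

text \<open>A map with domain \<open>S\<close> is a total function whose values off \<open>S\<close> are ignored.\<close>

definition separating :: "nat list set \<Rightarrow> (nat list \<Rightarrow> nat \<Rightarrow> complex) \<Rightarrow> bool" where
  "separating S \<phi> \<longleftrightarrow> (\<forall>\<mu>\<in>S. \<forall>\<nu>\<in>S. \<mu> \<parallel> \<nu> \<longrightarrow> supp (\<phi> \<mu>) \<inter> supp (\<phi> \<nu>) = {})"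

definition summative :: "real \<Rightarrow> nat list set \<Rightarrow> (nat list \<Rightarrow> nat \<Rightarrow> complex) \<Rightarrow> bool" where
  "summative p S \<phi> \<longleftrightarrow> (\<forall>\<nu>\<in>S. \<not> terminal S \<nu> \<longrightarrow> lp_has_sum p \<phi> (\<phi> \<nu>) (children S \<nu>))"

definition disintegration :: "real \<Rightarrow> nat list set \<Rightarrow> (nat list \<Rightarrow> nat \<Rightarrow> complex) \<Rightarrow> bool" where
  "disintegration p S \<phi> \<longleftrightarrow>
    is_tree S \<and> \<phi> ` S \<subseteq> lp p \<and> inj_on \<phi> S \<and> separating S \<phi> \<and> summative p S \<phi> \<and>
    (\<forall>\<nu>\<in>S. \<phi> \<nu> \<noteq> (\<lambda>_. 0)) \<and> linearly_dense p (\<phi> ` S)"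


section \<open>Computability on presentations\<close>

definition presentation :: "real \<Rightarrow> (nat \<Rightarrow> nat \<Rightarrow> complex) \<Rightarrow> bool" where
  "presentation p R \<longleftrightarrow> range R \<subseteq> lp p \<and> linearly_dense p (range R)"

text \<open>The rational vector named by a code for the list of its coefficients.\<close>

definition rat_vec :: "(nat \<Rightarrow> nat \<Rightarrow> complex) \<Rightarrow> nat \<Rightarrow> nat \<Rightarrow> complex" where
  "rat_vec R c = (\<lambda>n. \<Sum>j<length (list_decode c). gauss_code (list_decode c ! j) * R j n)"

definition rat_ball :: "real \<Rightarrow> (nat \<Rightarrow> nat \<Rightarrow> complex) \<Rightarrow> nat \<Rightarrow> nat \<Rightarrow> (nat \<Rightarrow> complex) set" where
  "rat_ball p R c r = {f \<in> lp p. lp_norm p (\<lambda>n. f n - rat_vec R c n) < rat_code r}"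

text \<open>
  The norm is a computable map into the complex numbers (with their standard presentation): some
  partial recursive \<open>P\<close> sends names of rational balls to names of rational balls of the complex
  plane that contain the norms of all points of the given ball, and the values of \<open>P\<close> converge
  to the norm of \<open>f\<close> along the rational balls that shrink to \<open>f\<close>. All small balls around \<open>f\<close> have
  to be handled, so that the norm can be computed from any sequence of rational approximations.
  If \<open>P\<close> only had to handle some balls around \<open>f\<close>, it could ignore those vectors \<open>R j\<close> that are
  not needed for density, and the norms of rational vectors need not be computable.
\<close>

definition computable_presentation :: "real \<Rightarrow> (nat \<Rightarrow> nat \<Rightarrow> complex) \<Rightarrow> bool" where
  "computable_presentation p R \<longleftrightarrow> presentation p R \<and>
    (\<exists>P. partrec P \<and>
      (\<forall>c r b s. 0 < rat_code r \<and> P (prod_encode (c, r)) = Some (prod_encode (b, s)) \<longrightarrow>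
         (\<forall>f\<in>rat_ball p R c r. complex_of_real (lp_norm p f) \<in> ball (gauss_code b) (rat_code s))) \<and>
      (\<forall>f\<in>lp p. \<forall>e>0. \<exists>d>0. \<forall>c r. 0 < rat_code r \<and> rat_code r < d \<and> f \<in> rat_ball p R c r \<longrightarrow>
         (\<exists>b s. P (prod_encode (c, r)) = Some (prod_encode (b, s)) \<and>
            ball (gauss_code b) (rat_code s) \<subseteq> ball (complex_of_real (lp_norm p f)) e)))"

definition computable_map ::
    "real \<Rightarrow> (nat \<Rightarrow> nat \<Rightarrow> complex) \<Rightarrow> nat list set \<Rightarrow> (nat list \<Rightarrow> nat \<Rightarrow> complex) \<Rightarrow> bool" where
  "computable_map p R S \<phi> \<longleftrightarrow> ce_set (list_encode ` S) \<and>
    (\<exists>F. partrec F \<and>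
      (\<forall>\<nu>\<in>S. \<forall>k. \<exists>c. F (prod_encode (list_encode \<nu>, k)) = Some c \<and>
         lp_norm p (\<lambda>n. \<phi> \<nu> n - rat_vec R c n) < 1 / 2 ^ k))"

definition lower_semicomputable :: "nat list set \<Rightarrow> (nat list \<Rightarrow> real) \<Rightarrow> bool" where
  "lower_semicomputable S \<epsilon> \<longleftrightarrow>
    ce_set {prod_encode (list_encode \<nu>, c) | \<nu> c. \<nu> \<in> S \<and> rat_code c < \<epsilon> \<nu>}"

text \<open>
  Membership of a node \<open>\<nu>\<close> of \<open>S\<close> in \<open>C n\<close> is decidable uniformly in \<open>n\<close>: the map taking \<open>(n, \<nu>)\<close>
  to the truth value of \<open>\<nu> \<in> C n\<close> is computable as a map with domain \<open>\<nat> \<times> S\<close>. For decidable \<open>S\<close>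
  this is decidability among all finite sequences. If \<open>S\<close> is merely c.e., then decidability among
  all finite sequences would be too much to ask of a partition of \<open>S\<close> into chains that continue
  through nonterminal nodes: if every nonterminal node had its children among two known
  sequences, one could decide which nodes are terminal.
\<close>

definition uniformly_computable :: "nat list set \<Rightarrow> (nat \<Rightarrow> nat list set) \<Rightarrow> bool" where
  "uniformly_computable S C \<longleftrightarrow>
    (\<exists>D. partrec D \<and>
      (\<forall>n \<nu>. D (prod_encode (n, list_encode \<nu>)) = (if \<nu> \<in> S then Some (of_bool (\<nu> \<in> C n)) else None)))"

end

theory Submission
  imports Defs
begin

text \<open>
  Every nonterminal node has at least two children, by injectivity and summativity. A child \<open>\<nu>'\<close> of
  \<open>\<nu>\<close> is certified to be good by rationals \<open>q < \<epsilon> \<nu>\<close> and \<open>t < \<parallel>\<phi> \<nu>'\<parallel>\<close> and \<open>u\<close> with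
  \<open>K (u - t) \<le> q\<close>, and by finitely many children of \<open>\<nu>\<close> such that \<open>u\<close> exceeds their norms and the
  norm of the difference of \<open>\<phi> \<nu>\<close> and their sum; as supports are disjoint, this difference
  dominates every other child. Here \<open>K\<close> is a fixed Lipschitz constant of the \<open>p\<close>-th power on the range
  of the norms, so powers with exponent \<open>p\<close> need not be computed. Certificates can be enumerated, and
  taking the first one selects one child of every nonterminal node. The chains follow the selected
  children, starting at the root of the tree or at a child that is not selected; there are
  infinitely many starting points, and they can be enumerated without repetition.
\<close>

section \<open>Total recursive functions\<close>

text \<open>\<open>S\<close> is merely c.e., so in general terminality of a node cannot be decided
  and the largest of possibly infinitely many children cannot be computed. This is why computability
  is handled through semidecidable predicates, which are closed under conjunction, disjunction,
  existential and bounded universal quantifiers but not under negation; partial recursive functions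
  are recovered from their graphs. Two negative statements have to be made positive. A nonempty node
  is known not to be selected as soon as a different child of its parent is seen to be selected;
  that search ends because the parent has a child. A node of \<open>S\<close> is known to lie
  outside a chain as soon as it is found on another one, so enumerability of the chains already
  gives decidability on \<open>S\<close>. Infinitely many starting points are needed because the
  nonempty chains are indexed by all naturals; this rests on \<open>S\<close> being infinite, which
  comes from the infinite dimension of the sequence space.\<close>

named_theorems rec_intros

definition pfst :: "nat \<Rightarrow> nat" where "pfst n = fst (prod_decode n)"
definition psnd :: "nat \<Rightarrow> nat" where "psnd n = snd (prod_decode n)"

lemma pfst_encode [simp]: "pfst (prod_encode (a, b)) = a"
  and psnd_encode [simp]: "psnd (prod_encode (a, b)) = b"
  by (simp_all add: pfst_def psnd_def)

lemma prod_encode_eta [simp]: "prod_encode (pfst n, psnd n) = n"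
  by (simp add: pfst_def psnd_def)

lemma pfst_0 [simp]: "pfst 0 = 0" and psnd_0 [simp]: "psnd 0 = 0"
  using pfst_encode[of 0 0] psnd_encode[of 0 0] by (simp_all add: prod_encode_def)

definition recf :: "(nat \<Rightarrow> nat) \<Rightarrow> bool" where
  "recf f \<longleftrightarrow> partrec (\<lambda>n. Some (f n))"

lemma recf_comp: "recf f \<Longrightarrow> recf g \<Longrightarrow> recf (\<lambda>n. f (g n))"
  unfolding recf_def using partrec_comp[of "\<lambda>n. Some (f n)" "\<lambda>n. Some (g n)"] by simp

lemma recf_pfst [rec_intros]: "recf f \<Longrightarrow> recf (\<lambda>n. pfst (f n))"
  using recf_comp[of pfst f] partrec_left by (simp add: recf_def pfst_def)

lemma recf_psnd [rec_intros]: "recf f \<Longrightarrow> recf (\<lambda>n. psnd (f n))"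
  using recf_comp[of psnd f] partrec_right by (simp add: recf_def psnd_def)

lemma recf_Suc [rec_intros]: "recf f \<Longrightarrow> recf (\<lambda>n. Suc (f n))"
  using recf_comp[of Suc f] partrec_succ by (simp add: recf_def)

lemma recf_pair [rec_intros]: "recf f \<Longrightarrow> recf g \<Longrightarrow> recf (\<lambda>n. prod_encode (f n, g n))"
  unfolding recf_def using partrec_pair[of "\<lambda>n. Some (f n)" "\<lambda>n. Some (g n)"] by simp

lemma recf_id [rec_intros]: "recf (\<lambda>n. n)"
  using partrec_pair[OF partrec_left partrec_right] by (simp add: recf_def)

lemma recf_const [rec_intros]: "recf (\<lambda>n. c)"
proof (induction c)
  case 0
  then show ?case using partrec_zero by (simp add: recf_def)
qed (rule recf_Suc)

text \<open>The whole input \<open>x\<close> is the parameter of the recursion: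
  \<open>partrec_prec\<close> is applied to the pair of \<open>x\<close> and \<open>m x\<close>, and
  since all values are defined, every \<open>Option.bind\<close> collapses.\<close>

lemma recf_rec_nat:
  assumes "recf F" and "recf (\<lambda>z. G (pfst z) (pfst (psnd z)) (psnd (psnd z)))" and "recf m"
  shows "recf (\<lambda>x. rec_nat (F x) (\<lambda>y r. G x y r) (m x))"
proof -
  let ?G = "\<lambda>z. G (pfst z) (pfst (psnd z)) (psnd (psnd z))"
  have *: "rec_nat (Some (F a)) (\<lambda>y r. Option.bind r (\<lambda>i. Some (?G (prod_encode (a, prod_encode (y, i)))))) k
      = Some (rec_nat (F a) (\<lambda>y r. G a y r) k)" for a k
    by (induction k) simp_all
  have "recf (\<lambda>n. rec_nat (F (pfst n)) (\<lambda>y r. G (pfst n) y r) (psnd n))"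
    using partrec_prec[of "\<lambda>n. Some (F n)" "\<lambda>n. Some (?G n)"] assms(1,2)
    unfolding recf_def * case_prod_beta pfst_def[symmetric] psnd_def[symmetric] by simp
  from recf_comp[OF this recf_pair[OF recf_id assms(3)]] show ?thesis by simp
qed

lemma recf_Least:
  assumes "recf (\<lambda>z. h (pfst z) (psnd z))" and "\<And>x. \<exists>k. h x k = (0::nat)"
  shows "recf (\<lambda>x. LEAST k. h x k = 0)"
proof -
  have "mu_search (\<lambda>k. Some (h a k)) = Some (LEAST k. h a k = 0)" for a
  proof -
    have "h a (LEAST k. h a k = 0) = 0"
      using assms(2) by (rule LeastI_ex)
    moreover have "\<exists>y. h a j = Suc y" if "j < (LEAST k. h a k = 0)" for j
      using not_less_Least[OF that] not0_implies_Suc by blast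
    ultimately show ?thesis
      unfolding mu_search_def by auto
  qed
  then show ?thesis
    using partrec_mu[OF assms(1)[unfolded recf_def]] by (simp add: recf_def)
qed

text \<open>The recursion step returns its counter and ignores the previous value, so the result at
  \<open>Suc y\<close> is \<open>y\<close>. Iterating it gives truncated subtraction, the basis of
  all comparisons below.\<close>

lemma recf_pred: "recf f \<Longrightarrow> recf (\<lambda>x. f x - 1)"
proof -
  have "rec_nat 0 (\<lambda>y r. y) n = n - 1" for n
    by (cases n) simp_all
  moreover have "recf f \<Longrightarrow> recf (\<lambda>x. rec_nat 0 (\<lambda>y r. y) (f x))"
    by (rule recf_rec_nat) (intro rec_intros | assumption)+
  ultimately show "recf f \<Longrightarrow> ?thesis" by simp
qed

lemma recf_add [rec_intros]: "recf f \<Longrightarrow> recf g \<Longrightarrow> recf (\<lambda>x. f x + g x)"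
proof -
  have "rec_nat a (\<lambda>y r. Suc r) n = a + n" for a n
    by (induction n) simp_all
  moreover have "recf f \<Longrightarrow> recf g \<Longrightarrow> recf (\<lambda>x. rec_nat (f x) (\<lambda>y r. Suc r) (g x))"
    by (rule recf_rec_nat) (intro rec_intros | assumption)+
  ultimately show "recf f \<Longrightarrow> recf g \<Longrightarrow> ?thesis" by simp
qed

lemma recf_diff [rec_intros]: "recf f \<Longrightarrow> recf g \<Longrightarrow> recf (\<lambda>x. f x - g x)"
proof -
  have "rec_nat a (\<lambda>y r. r - 1) n = a - n" for a n :: nat
    by (induction n) simp_all
  moreover have "recf f \<Longrightarrow> recf g \<Longrightarrow> recf (\<lambda>x. rec_nat (f x) (\<lambda>y r. r - 1) (g x))"
    by (rule recf_rec_nat) (intro rec_intros recf_pred | assumption)+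
  ultimately show "recf f \<Longrightarrow> recf g \<Longrightarrow> ?thesis" by simp
qed

lemma recf_mult [rec_intros]: "recf f \<Longrightarrow> recf g \<Longrightarrow> recf (\<lambda>x. f x * g x)"
proof -
  have "rec_nat 0 (\<lambda>y r. r + a) n = a * n" for a n :: nat
    by (induction n) simp_all
  moreover have "recf (\<lambda>x. rec_nat 0 (\<lambda>y r. r + f x) (g x))" if "recf f" "recf g"
    by (rule recf_rec_nat) (intro rec_intros recf_comp[OF that(1)] that(2))+
  ultimately show "recf f \<Longrightarrow> recf g \<Longrightarrow> ?thesis" by simp
qed

section \<open>Decidable predicates\<close>

definition decp :: "(nat \<Rightarrow> bool) \<Rightarrow> bool" where
  "decp P \<longleftrightarrow> recf (\<lambda>x. of_bool (P x))"

lemma decp_comp: "decp P \<Longrightarrow> recf f \<Longrightarrow> decp (\<lambda>x. P (f x))"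
  unfolding decp_def by (rule recf_comp)

lemma decp_not [rec_intros]: "decp P \<Longrightarrow> decp (\<lambda>x. \<not> P x)"
proof -
  have "recf (\<lambda>x. 1 - of_bool (P x))" if "decp P"
    using that unfolding decp_def by (intro rec_intros)
  moreover have "of_bool (\<not> P x) = (1::nat) - of_bool (P x)" for x by simp
  ultimately show "decp P \<Longrightarrow> ?thesis"
    unfolding decp_def by presburger
qed

lemma decp_conj [rec_intros]: "decp P \<Longrightarrow> decp Q \<Longrightarrow> decp (\<lambda>x. P x \<and> Q x)"
  unfolding decp_def of_bool_conj by (intro rec_intros)

lemma decp_disj [rec_intros]: "decp P \<Longrightarrow> decp Q \<Longrightarrow> decp (\<lambda>x. P x \<or> Q x)"
  using decp_not[OF decp_conj[OF decp_not decp_not], of P Q] by simp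

lemma decp_less [rec_intros]: "recf f \<Longrightarrow> recf g \<Longrightarrow> decp (\<lambda>x. f x < g x)"
proof -
  \<comment> \<open>With truncated subtraction, \<open>1 - (1 - d)\<close> is the sign of
    \<open>d\<close>.\<close>
  have "of_bool (f x < g x) = 1 - (1 - (g x - f x))" for x by simp
  then show "recf f \<Longrightarrow> recf g \<Longrightarrow> ?thesis"
    unfolding decp_def by (simp only:) (intro rec_intros)
qed

lemma decp_le [rec_intros]: "recf f \<Longrightarrow> recf g \<Longrightarrow> decp (\<lambda>x. f x \<le> g x)"
  using decp_not[OF decp_less, of g f] by (simp add: not_less)

lemma decp_eq [rec_intros]: "recf f \<Longrightarrow> recf g \<Longrightarrow> decp (\<lambda>x. f x = g x)"
  unfolding eq_iff by (intro rec_intros)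

lemma decp_all_less [rec_intros]:
  assumes "decp (\<lambda>z. P (pfst z) (psnd z))" and "recf n"
  shows "decp (\<lambda>x. \<forall>i<n x. P x i)"
proof -
  have "rec_nat (1::nat) (\<lambda>y r. r * of_bool (P x y)) m = of_bool (\<forall>i<m. P x i)"
    for x m :: nat
    by (induction m) (auto simp: less_Suc_eq)
  moreover have "recf (\<lambda>x. rec_nat (1::nat) (\<lambda>y r. r * of_bool (P x y)) (n x))"
  proof (rule recf_rec_nat)
    have "decp (\<lambda>z. P (pfst z) (pfst (psnd z)))"
      using decp_comp[OF assms(1) recf_pair, of pfst "\<lambda>z. pfst (psnd z)"]
      by (simp add: recf_pfst recf_psnd recf_id)
    then show "recf (\<lambda>z. psnd (psnd z) * of_bool (P (pfst z) (pfst (psnd z))))"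
      unfolding decp_def by (intro rec_intros)
  qed (intro rec_intros assms(2))+
  ultimately show ?thesis by (simp add: decp_def)
qed

lemma recf_LEAST:
  assumes "decp (\<lambda>z. P (pfst z) (psnd z))" and "\<And>x. \<exists>k. P x k"
  shows "recf (\<lambda>x. LEAST k. P x k)"
  using recf_Least[of "\<lambda>x k. of_bool (\<not> P x k)"] decp_not[OF assms(1)] assms(2)
  unfolding decp_def by simp

lemma recf_If [rec_intros]:
  assumes "decp P" and "recf f" and "recf g"
  shows "recf (\<lambda>x. if P x then f x else g x)"
proof -
  have "(if P x then f x else g x) = of_bool (P x) * f x + (1 - of_bool (P x)) * g x" for x
    by simp
  with assms show ?thesis
    unfolding decp_def by (simp only:) (intro rec_intros)
qed

section \<open>Coded lists\<close>

text \<open>The default 0 beyond the end makes the function total; as a coefficient, the code 0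
  names the number 0, so short lists behave as if padded with zeros.\<close>

definition cnth :: "nat \<Rightarrow> nat \<Rightarrow> nat" where
  "cnth l i = (if i < length (list_decode l) then list_decode l ! i else 0)"

definition clen :: "nat \<Rightarrow> nat" where
  "clen l = length (list_decode l)"

text \<open>A nonempty list is coded by the successor of the pair of its head and the code of its
  tail, so one step of this recursion removes the head. The code 0 of the empty list stays
  0.\<close>

definition cdrop :: "nat \<Rightarrow> nat \<Rightarrow> nat" where
  "cdrop l i = rec_nat l (\<lambda>_ r. psnd (r - 1)) i"

lemma cdrop_eq: "cdrop l i = list_encode (drop i (list_decode l))"
proof (induction i)
  case 0
  then show ?case by (simp add: cdrop_def)
next
  case (Suc i)
  have "psnd (list_encode xs - 1) = list_encode (tl xs)" for xs
    by (cases xs) simp_all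
  with Suc show ?case by (simp add: cdrop_def drop_Suc tl_drop)
qed

lemma cdrop_eq_0: "cdrop l i = 0 \<longleftrightarrow> clen l \<le> i"
proof -
  have "list_encode xs = 0 \<longleftrightarrow> xs = []" for xs by (cases xs) simp_all
  then show ?thesis by (simp add: cdrop_eq clen_def)
qed

lemma cnth_eq: "cnth l i = pfst (cdrop l i - 1)"
proof (cases "i < length (list_decode l)")
  case True
  then show ?thesis by (simp add: cnth_def cdrop_eq Cons_nth_drop_Suc[symmetric])
qed (simp add: cnth_def cdrop_eq)

lemma recf_cdrop: "recf f \<Longrightarrow> recf g \<Longrightarrow> recf (\<lambda>x. cdrop (f x) (g x))"
  unfolding cdrop_def by (rule recf_rec_nat) (intro rec_intros | assumption)+

lemma recf_cnth [rec_intros]: "recf f \<Longrightarrow> recf g \<Longrightarrow> recf (\<lambda>x. cnth (f x) (g x))"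
  unfolding cnth_eq by (intro rec_intros recf_cdrop)

lemma recf_clen [rec_intros]: "recf f \<Longrightarrow> recf (\<lambda>x. clen (f x))"
proof -
  have "clen l = (LEAST k. cdrop l k = 0)" for l
    unfolding cdrop_eq_0 by (rule Least_equality[symmetric]) simp_all
  moreover have "recf (\<lambda>x. LEAST k. cdrop x k = 0)"
    by (rule recf_LEAST) (intro rec_intros recf_cdrop, use cdrop_eq_0 in blast)
  ultimately have "recf clen" by presburger
  then show "recf f \<Longrightarrow> ?thesis" by (rule recf_comp)
qed

text \<open>Lets codes themselves serve as bounds for quantifiers over the entries of a list, as in
  \<open>vadd\<close>.\<close>

lemma clen_le: "clen l \<le> l"
proof -
  have "length xs \<le> list_encode xs" for xs
  proof (induction xs)
    case (Cons x xs)
    then show ?case using le_prod_encode_2[of "list_encode xs" x] by simp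
  qed simp
  from this[of "list_decode l"] show ?thesis by (simp add: clen_def)
qed

text \<open>The source of all finite witnesses: finitely many numbers are packed into one.\<close>

lemma ex_cnth: "\<exists>l. clen l = n \<and> (\<forall>i<n. cnth l i = v i)"
  by (rule exI[of _ "list_encode (map v [0..<n])"]) (simp add: clen_def cnth_def)

lemma list_decode_snoc_iff:
  "list_decode b = list_decode a @ [k] \<longleftrightarrow>
    clen b = Suc (clen a) \<and> (\<forall>i<clen a. cnth b i = cnth a i) \<and> k = cnth b (clen a)"
proof -
  have "xs = ys @ [k] \<longleftrightarrow>
      length xs = Suc (length ys) \<and> (\<forall>i<length ys. xs ! i = ys ! i) \<and> xs ! length ys = k" for xs ys
    unfolding list_eq_iff_nth_eq by (auto simp: nth_append less_Suc_eq)
  then show ?thesis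
    unfolding clen_def cnth_def by (auto simp: less_SucI)
qed

text \<open>The entry \<open>k\<close> can be read off from the longer list, so the quantifier
  disappears and only lengths and entries remain to be compared.\<close>

lemma decp_child [rec_intros]:
  assumes "recf f" and "recf g"
  shows "decp (\<lambda>x. \<exists>k. list_decode (g x) = list_decode (f x) @ [k])"
proof -
  have "(\<exists>k. list_decode b = list_decode a @ [k]) \<longleftrightarrow>
      clen b = Suc (clen a) \<and> (\<forall>i<clen a. cnth b i = cnth a i)" for a b
    unfolding list_decode_snoc_iff by auto
  then show ?thesis
    by (simp only:) (intro rec_intros recf_comp[OF assms(1)] recf_comp[OF assms(2)])
qed

section \<open>Semidecidable predicates\<close>

text \<open>The Sigma-1 form of a c.e. predicate. Logical closure properties reduce to coding
  several witnesses as one number, without building any search function.\<close>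

definition sig1 :: "(nat \<Rightarrow> bool) \<Rightarrow> bool" where
  "sig1 P \<longleftrightarrow> (\<exists>D. decp (\<lambda>z. D (pfst z) (psnd z)) \<and> (\<forall>x. P x \<longleftrightarrow> (\<exists>k. D x k)))"

lemma decp_comp2: "decp (\<lambda>z. D (pfst z) (psnd z)) \<Longrightarrow> recf f \<Longrightarrow> recf g \<Longrightarrow> decp (\<lambda>x. D (f x) (g x))"
  using decp_comp[OF _ recf_pair, of "\<lambda>z. D (pfst z) (psnd z)" f g] by simp

lemma sig1I: "decp (\<lambda>z. D (pfst z) (psnd z)) \<Longrightarrow> (\<And>x. P x \<longleftrightarrow> (\<exists>k. D x k)) \<Longrightarrow> sig1 P"
  unfolding sig1_def by blast

lemma sig1E:
  assumes "sig1 P"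
  obtains D where "decp (\<lambda>z. D (pfst z) (psnd z))" and "\<And>x. P x \<longleftrightarrow> (\<exists>k. D x k)"
  using assms unfolding sig1_def by blast

lemma sig1_comp: "sig1 P \<Longrightarrow> recf f \<Longrightarrow> sig1 (\<lambda>x. P (f x))"
proof (elim sig1E)
  fix D assume D: "decp (\<lambda>z. D (pfst z) (psnd z))" "\<And>x. P x \<longleftrightarrow> (\<exists>k. D x k)" and f: "recf f"
  show ?thesis
  proof (rule sig1I)
    show "decp (\<lambda>z. D (f (pfst z)) (psnd z))"
      by (intro decp_comp2[OF D(1)] rec_intros recf_comp[OF f])
  qed (rule D(2))
qed

lemma sig1_comp2: "sig1 (\<lambda>z. P (pfst z) (psnd z)) \<Longrightarrow> recf f \<Longrightarrow> recf g \<Longrightarrow> sig1 (\<lambda>x. P (f x) (g x))"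
  using sig1_comp[OF _ recf_pair, of "\<lambda>z. P (pfst z) (psnd z)" f g] by simp

lemma decp_sig1: "decp P \<Longrightarrow> sig1 P"
  by (rule sig1I[of "\<lambda>x k. P x"]) (simp_all add: decp_comp recf_pfst recf_id)

lemma sig1_ex [rec_intros]:
  assumes "sig1 (\<lambda>z. P (pfst z) (psnd z))"
  shows "sig1 (\<lambda>x. \<exists>y. P x y)"
proof -
  obtain D where D: "decp (\<lambda>z. D (pfst z) (psnd z))"
    and PD: "\<And>x. P (pfst x) (psnd x) \<longleftrightarrow> (\<exists>k. D x k)"
    using assms unfolding sig1_def by auto
  show ?thesis
  proof (rule sig1I)
    show "decp (\<lambda>z. D (prod_encode (pfst z, pfst (psnd z))) (psnd (psnd z)))"
      by (intro decp_comp2[OF D] rec_intros)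
    show "(\<exists>y. P x y) \<longleftrightarrow> (\<exists>k. D (prod_encode (x, pfst k)) (psnd k))" for x
    proof -
      have "P x y \<longleftrightarrow> (\<exists>k. D (prod_encode (x, y)) k)" for y
        using PD[of "prod_encode (x, y)"] by simp
      then show ?thesis by (metis pfst_encode psnd_encode)
    qed
  qed
qed

lemma sig1_conj [rec_intros]: "sig1 P \<Longrightarrow> sig1 Q \<Longrightarrow> sig1 (\<lambda>x. P x \<and> Q x)"
proof (elim sig1E)
  fix D E
  assume D: "decp (\<lambda>z. D (pfst z) (psnd z))" "\<And>x. P x \<longleftrightarrow> (\<exists>k. D x k)"
    and E: "decp (\<lambda>z. E (pfst z) (psnd z))" "\<And>x. Q x \<longleftrightarrow> (\<exists>k. E x k)"
  show ?thesis
  proof (rule sig1I)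
    show "decp (\<lambda>z. D (pfst z) (pfst (psnd z)) \<and> E (pfst z) (psnd (psnd z)))"
      by (intro rec_intros decp_comp2[OF D(1)] decp_comp2[OF E(1)])
    show "P x \<and> Q x \<longleftrightarrow> (\<exists>k. D x (pfst k) \<and> E x (psnd k))" for x
      unfolding D(2) E(2) by (metis pfst_encode psnd_encode)
  qed
qed

lemma sig1_disj [rec_intros]: "sig1 P \<Longrightarrow> sig1 Q \<Longrightarrow> sig1 (\<lambda>x. P x \<or> Q x)"
proof (elim sig1E)
  fix D E
  assume D: "decp (\<lambda>z. D (pfst z) (psnd z))" "\<And>x. P x \<longleftrightarrow> (\<exists>k. D x k)"
    and E: "decp (\<lambda>z. E (pfst z) (psnd z))" "\<And>x. Q x \<longleftrightarrow> (\<exists>k. E x k)"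
  show ?thesis
  proof (rule sig1I)
    show "decp (\<lambda>z. D (pfst z) (psnd z) \<or> E (pfst z) (psnd z))"
      by (intro rec_intros D(1) E(1))
  qed (use D(2) E(2) in blast)
qed

text \<open>The witnesses for all \<open>i < n x\<close> are collected in one coded list, which
  pulls the existential quantifier in front of the bounded one.\<close>

lemma sig1_all_less [rec_intros]:
  assumes "sig1 (\<lambda>z. P (pfst z) (psnd z))" and n: "recf n"
  shows "sig1 (\<lambda>x. \<forall>i<n x. P x i)"
proof -
  obtain D where D: "decp (\<lambda>z. D (pfst z) (psnd z))"
    and PD: "\<And>x. P (pfst x) (psnd x) \<longleftrightarrow> (\<exists>k. D x k)"
    using assms(1) unfolding sig1_def by auto
  have P: "P x y \<longleftrightarrow> (\<exists>k. D (prod_encode (x, y)) k)" for x y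
    using PD[of "prod_encode (x, y)"] by simp
  show ?thesis
  proof (rule sig1I)
    show "decp (\<lambda>z. \<forall>i<n (pfst z). D (prod_encode (pfst z, i)) (cnth (psnd z) i))"
      by (intro rec_intros decp_comp2[OF D] recf_comp[OF n])
    show "(\<forall>i<n x. P x i) \<longleftrightarrow> (\<exists>l. \<forall>i<n x. D (prod_encode (x, i)) (cnth l i))" for x
    proof
      assume "\<forall>i<n x. P x i"
      then obtain v where "\<forall>i<n x. D (prod_encode (x, i)) (v i)"
        unfolding P by metis
      moreover obtain l where "\<forall>i<n x. cnth l i = v i"
        using ex_cnth by blast
      ultimately show "\<exists>l. \<forall>i<n x. D (prod_encode (x, i)) (cnth l i)" by metis
    qed (use P in blast)
  qed
qed

lemma sig1_eq [rec_intros]: "recf f \<Longrightarrow> recf g \<Longrightarrow> sig1 (\<lambda>x. f x = g x)"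
  and sig1_neq [rec_intros]: "recf f \<Longrightarrow> recf g \<Longrightarrow> sig1 (\<lambda>x. f x \<noteq> g x)"
  and sig1_child [rec_intros]: "recf f \<Longrightarrow> recf g \<Longrightarrow> sig1 (\<lambda>x. \<exists>k. list_decode (g x) = list_decode (f x) @ [k])"
  by (intro decp_sig1 rec_intros; assumption)+

text \<open>A computation is witnessed by its intermediate values, in the spirit of Kleene's normal
  form theorem. For unbounded search, the condition that earlier values are defined and nonzero is
  stated positively, as being successors.\<close>

lemma partrec_graph_sig1:
  "partrec f \<Longrightarrow> sig1 (\<lambda>z. f (pfst z) = Some (psnd z))"
proof (induction rule: partrec.induct)
  case partrec_zero
  have "sig1 (\<lambda>z. 0 = psnd z)" by (intro rec_intros)
  then show ?case by simp
next
  case partrec_succ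
  have "sig1 (\<lambda>z. Suc (pfst z) = psnd z)" by (intro rec_intros)
  then show ?case by simp
next
  case partrec_left
  have "sig1 (\<lambda>z. pfst (pfst z) = psnd z)" by (intro rec_intros)
  then show ?case by (simp add: pfst_def)
next
  case partrec_right
  have "sig1 (\<lambda>z. psnd (pfst z) = psnd z)" by (intro rec_intros)
  then show ?case by (simp add: psnd_def)
next
  case (partrec_pair f g)
  have "sig1 (\<lambda>z. \<exists>a b. f (pfst z) = Some a \<and> g (pfst z) = Some b \<and> prod_encode (a, b) = psnd z)"
    by (intro rec_intros sig1_comp2[OF partrec_pair.IH(1)] sig1_comp2[OF partrec_pair.IH(2)])
  then show ?case by (simp add: bind_eq_Some_conv)
next
  case (partrec_comp f g)
  have "sig1 (\<lambda>z. \<exists>a. g (pfst z) = Some a \<and> f a = Some (psnd z))"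
    by (intro rec_intros sig1_comp2[OF partrec_comp.IH(1)] sig1_comp2[OF partrec_comp.IH(2)])
  then show ?case by (simp add: bind_eq_Some_conv)
next
  case (partrec_prec f g)
  let ?r = "\<lambda>a m. rec_nat (f a)
    (\<lambda>y r. Option.bind r (\<lambda>i. g (prod_encode (a, prod_encode (y, i))))) m"
  \<comment> \<open>\<open>l\<close> is the course of values of the recursion: entry 0 is the start
    value, entry \<open>i + 1\<close> comes from entry \<open>i\<close>, and the last entry is the
    result.\<close>
  have "sig1 (\<lambda>z. \<exists>l. f (pfst (pfst z)) = Some (cnth l 0) \<and>
      (\<forall>i<psnd (pfst z). g (prod_encode (pfst (pfst z), prod_encode (i, cnth l i))) = Some (cnth l (Suc i))) \<and>
      cnth l (psnd (pfst z)) = psnd z)"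
    by (intro rec_intros sig1_comp2[OF partrec_prec.IH(1)] sig1_comp2[OF partrec_prec.IH(2)])
  moreover have "?r a m = Some y \<longleftrightarrow> (\<exists>l. f a = Some (cnth l 0) \<and>
      (\<forall>i<m. g (prod_encode (a, prod_encode (i, cnth l i))) = Some (cnth l (Suc i))) \<and> cnth l m = y)"
    for a m y
  proof
    assume y: "?r a m = Some y"
    \<comment> \<open>Divergence propagates through \<open>Option.bind\<close>, so definedness at
      \<open>m\<close> descends to all smaller arguments.\<close>
    have def: "\<exists>v. ?r a i = Some v" if "i \<le> m" for i
      using that
    proof (induction rule: inc_induct)
      case (step n)
      then show ?case by (auto simp: bind_eq_Some_conv)
    qed (use y in simp)
    obtain l where l: "\<forall>i<Suc m. cnth l i = the (?r a i)"
      using ex_cnth[of "Suc m" "\<lambda>i. the (?r a i)"] by blast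
    have l': "?r a i = Some (cnth l i)" if "i \<le> m" for i
      using def[OF that] l that by auto
    have "g (prod_encode (a, prod_encode (i, cnth l i))) = Some (cnth l (Suc i))" if "i < m" for i
      using l'[of i] l'[of "Suc i"] that by simp
    then show "\<exists>l. f a = Some (cnth l 0) \<and>
      (\<forall>i<m. g (prod_encode (a, prod_encode (i, cnth l i))) = Some (cnth l (Suc i))) \<and> cnth l m = y"
      using l'[of 0] l'[of m] y by auto
  next
    assume "\<exists>l. f a = Some (cnth l 0) \<and>
      (\<forall>i<m. g (prod_encode (a, prod_encode (i, cnth l i))) = Some (cnth l (Suc i))) \<and> cnth l m = y"
    then obtain l where l: "f a = Some (cnth l 0)" "cnth l m = y"
      "\<And>i. i < m \<Longrightarrow> g (prod_encode (a, prod_encode (i, cnth l i))) = Some (cnth l (Suc i))" by blast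
    have "i \<le> m \<Longrightarrow> ?r a i = Some (cnth l i)" for i
      by (induction i) (use l in simp_all)
    then show "?r a m = Some y" using l(2) by blast
  qed
  ultimately show ?case
    unfolding case_prod_beta pfst_def[symmetric] psnd_def[symmetric] by simp
next
  case (partrec_mu f)
  have "sig1 (\<lambda>z. f (prod_encode (pfst z, psnd z)) = Some 0 \<and>
      (\<forall>j<psnd z. \<exists>v. f (prod_encode (pfst z, j)) = Some (Suc v)))"
    by (intro rec_intros sig1_comp2[OF partrec_mu.IH])
  moreover have "mu_search h = Some y \<longleftrightarrow> h y = Some 0 \<and> (\<forall>j<y. \<exists>v. h j = Some (Suc v))" for h y
  proof -
    have L: "(LEAST k. h k = Some 0) = y" if "h y = Some 0" "\<forall>j<y. \<exists>v. h j = Some (Suc v)" for y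
    proof (rule Least_equality)
      show "y \<le> k" if "h k = Some 0" for k
        using that \<open>\<forall>j<y. \<exists>v. h j = Some (Suc v)\<close> by (metis Zero_not_Suc not_le option.inject)
    qed fact
    show ?thesis
    proof (cases "\<exists>k. h k = Some 0 \<and> (\<forall>j<k. \<exists>v. h j = Some (Suc v))")
      case True
      then obtain k where k: "h k = Some 0" "\<forall>j<k. \<exists>v. h j = Some (Suc v)" by blast
      have "mu_search h = Some k" unfolding mu_search_def if_P[OF True] L[OF k] ..
      then show ?thesis using k L[of y] L[OF k] by auto
    next
      case False
      then have "mu_search h = None" unfolding mu_search_def by (rule if_not_P)
      with False show ?thesis by auto
    qed
  qed
  ultimately show ?case by simp
qed

text \<open>Searching for the least code of a pair of a value and a witness turns a semidecidable
  relation into a partial recursive choice function.\<close>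

lemma sig1_uniformize:
  assumes "sig1 (\<lambda>z. Q (pfst z) (psnd z))"
  obtains h where "partrec h" "\<And>x y. h x = Some y \<Longrightarrow> Q x y" "\<And>x y. Q x y \<Longrightarrow> h x \<noteq> None"
proof -
  obtain D where D: "decp (\<lambda>z. D (pfst z) (psnd z))"
    and QD: "\<And>z. Q (pfst z) (psnd z) \<longleftrightarrow> (\<exists>k. D z k)"
    using assms unfolding sig1_def by auto
  define E where "E x w \<longleftrightarrow> D (prod_encode (x, pfst w)) (psnd w)" for x w
  have Q: "Q x y \<longleftrightarrow> (\<exists>k. E x (prod_encode (y, k)))" for x y
    using QD[of "prod_encode (x, y)"] by (simp add: E_def)
  define h where "h a = Option.bind (mu_search (\<lambda>k. Some (of_bool (\<not> E a k)))) (\<lambda>w. Some (pfst w))" for a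
  have "decp (\<lambda>z. \<not> E (pfst z) (psnd z))"
    unfolding E_def by (intro rec_intros decp_comp2[OF D])
  then have "partrec (\<lambda>a. mu_search (\<lambda>k. Some (of_bool (\<not> E a k))))"
    using partrec_mu[of "\<lambda>z. Some (of_bool (\<not> E (pfst z) (psnd z)))"] by (simp add: decp_def recf_def)
  then have "partrec h"
    unfolding h_def using partrec_comp[OF partrec_left] by (simp add: pfst_def)
  moreover have mu: "mu_search (\<lambda>k. Some (of_bool (\<not> E a k))) = (if \<exists>k. E a k then Some (LEAST k. E a k) else None)" for a
  proof -
    let ?h = "\<lambda>k. Some (of_bool (\<not> E a k) :: nat)"
    have h0: "(?h k = Some 0) = E a k" "(\<exists>v. ?h k = Some (Suc v)) = (\<not> E a k)" for k
      by auto
    show ?thesis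
      unfolding mu_search_def h0 exists_least_iff[of "E a", symmetric] ..
  qed
  have "Q x y" if "h x = Some y" for x y
  proof -
    from that have "\<exists>k. E x k" "y = pfst (LEAST k. E x k)"
      unfolding h_def mu by (auto split: if_splits)
    then show ?thesis
      unfolding Q using LeastI_ex[of "E x"] by (metis prod_encode_eta)
  qed
  moreover have "h x \<noteq> None" if "Q x y" for x y
    using that unfolding Q h_def mu by auto
  ultimately show thesis by (rule that)
qed

text \<open>A choice function for a single-valued relation is the function itself. This is the
  converse of \<open>partrec_graph_sig1\<close>.\<close>

lemma sig1_graph_partrec:
  assumes "sig1 (\<lambda>z. f (pfst z) = Some (psnd z))"
  shows "partrec f"
proof -
  obtain h where "partrec h" "\<And>x y. h x = Some y \<Longrightarrow> f x = Some y" "\<And>x y. f x = Some y \<Longrightarrow> h x \<noteq> None"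
    using sig1_uniformize[OF assms] by blast
  moreover from this(2,3) have "h = f"
    by (metis ext not_Some_eq)
  ultimately show ?thesis by simp
qed

lemma ce_set_sig1: "ce_set A \<Longrightarrow> sig1 (\<lambda>x. x \<in> A)"
proof -
  assume "ce_set A"
  then obtain f where f: "partrec f" "A = dom f" unfolding ce_set_def by blast
  have "sig1 (\<lambda>x. \<exists>y. f x = Some y)"
    by (intro rec_intros sig1_comp2[OF partrec_graph_sig1[OF f(1)]])
  then show ?thesis by (simp add: f(2) dom_def)
qed

text \<open>The witness is a finite path, given by its length and a coded list of its vertices.
  Surjectivity of the decoding \<open>d\<close> provides codes for the intermediate
  vertices.\<close>

lemma sig1_rtrancl:
  assumes "sig1 (\<lambda>z. (d (pfst z), d (psnd z)) \<in> r)" and "bij d"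
  shows "sig1 (\<lambda>z. (d (pfst z), d (psnd z)) \<in> r\<^sup>*)"
proof -
  let ?path = "\<lambda>x y n l. cnth l 0 = x \<and> (\<forall>i<n. (d (cnth l i), d (cnth l (Suc i))) \<in> r) \<and> cnth l n = y"
  have "sig1 (\<lambda>z. \<exists>n l. ?path (pfst z) (psnd z) n l)"
    by (intro rec_intros sig1_comp2[OF assms(1)])
  moreover have "(d x, d y) \<in> r\<^sup>* \<longleftrightarrow> (\<exists>n l. ?path x y n l)" for x y
  proof
    assume "(d x, d y) \<in> r\<^sup>*"
    then obtain n f where f: "f 0 = d x" "f n = d y" "\<forall>i<n. (f i, f (Suc i)) \<in> r"
      unfolding rtrancl_power relpow_fun_conv by blast
    obtain l where "\<forall>i<Suc n. cnth l i = inv d (f i)"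
      using ex_cnth[of "Suc n" "\<lambda>i. inv d (f i)"] by blast
    with f assms(2) have "?path x y n l"
      by (simp add: bij_is_surj surj_f_inv_f bij_is_inj)
    then show "\<exists>n l. ?path x y n l" by blast
  next
    assume "\<exists>n l. ?path x y n l"
    then obtain n l where "?path x y n l" by blast
    then have "(d x, d y) \<in> r ^^ n"
      unfolding relpow_fun_conv by (intro exI[of _ "\<lambda>i. d (cnth l i)"]) auto
    then show "(d x, d y) \<in> r\<^sup>*" by (rule relpow_imp_rtrancl)
  qed
  ultimately show ?thesis by simp
qed

text \<open>Every element is enumerated together with its least witness only, which makes the
  enumeration injective.\<close>

lemma sig1_infinite_enumeration:
  assumes "sig1 (\<lambda>x. x \<in> A)" and "infinite A"
  obtains e where "recf e" "inj e" "range e = A"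
proof -
  from assms(1) obtain D where D: "decp (\<lambda>z. D (pfst z) (psnd z))"
    and AD: "\<And>x. x \<in> A \<longleftrightarrow> (\<exists>k. D x k)" by (rule sig1E) blast
  define W where "W = {w. D (pfst w) (psnd w) \<and> (\<forall>k<psnd w. \<not> D (pfst w) k)}"
  have W: "pfst ` W = A"
  proof (intro equalityI subsetI)
    fix x assume "x \<in> A"
    then obtain k where "D x k" "\<forall>j<k. \<not> D x j"
      unfolding AD exists_least_iff[of "D x"] by blast
    then have "prod_encode (x, k) \<in> W" by (simp add: W_def)
    then show "x \<in> pfst ` W" by force
  qed (use AD in \<open>auto simp: W_def\<close>)
  have inj: "inj_on pfst W"
  proof (rule inj_onI)
    fix v w assume "v \<in> W" "w \<in> W" "pfst v = pfst w"
    moreover from this have "psnd v = psnd w"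
      unfolding W_def by (metis (mono_tags, lifting) linorder_neqE_nat mem_Collect_eq)
    ultimately show "v = w" by (metis prod_encode_eta)
  qed
  have inf: "infinite W" using assms(2) W by auto
  \<comment> \<open>Unlike \<open>A\<close>, the set \<open>W\<close> is decidable, so its elements
    can be listed in increasing order by searching for the next one.\<close>
  have decW: "decp (\<lambda>w. w \<in> W)"
    unfolding W_def mem_Collect_eq by (intro rec_intros decp_comp2[OF D])
  have next_rec: "recf (\<lambda>m. LEAST s. s \<in> W \<and> m < s)"
  proof (rule recf_LEAST)
    show "\<exists>k. k \<in> W \<and> m < k" for m
      using inf unfolding infinite_nat_iff_unbounded by blast
  qed (intro rec_intros decp_comp[OF decW])
  have rec: "rec_nat (enumerate W 0) (\<lambda>_ m. LEAST s. s \<in> W \<and> m < s) n = enumerate W n" for n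
    by (induction n) (simp_all add: enumerate_Suc''[OF inf])
  have "recf (\<lambda>n. rec_nat (enumerate W 0) (\<lambda>_ m. LEAST s. s \<in> W \<and> m < s) n)"
    by (rule recf_rec_nat) (intro rec_intros recf_comp[OF next_rec])+
  then have "recf (\<lambda>n. pfst (enumerate W n))" unfolding rec by (rule recf_pfst)
  moreover have "inj (\<lambda>n. pfst (enumerate W n))"
    using comp_inj_on[of "enumerate W" UNIV pfst] inj bij_enumerate[OF inf]
    by (simp add: bij_betw_def comp_def)
  moreover have "range (\<lambda>n. pfst (enumerate W n)) = A"
    using W range_enumerate[OF inf] by (metis image_image)
  ultimately show thesis by (rule that)
qed

section \<open>Coded rationals\<close>

text \<open>Recursive functions have natural values only, so a sign is represented by a difference
  \<open>p - q\<close> of two of them, over a positive denominator that makes comparisons reduce to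
  numerators.\<close>

definition ratf :: "(nat \<Rightarrow> real) \<Rightarrow> bool" where
  "ratf g \<longleftrightarrow> (\<exists>p q d. recf p \<and> recf q \<and> recf d \<and>
    (\<forall>x. 0 < d x \<and> g x = (real (p x) - real (q x)) / real (d x)))"

lemma ratfI:
  "recf p \<Longrightarrow> recf q \<Longrightarrow> recf d \<Longrightarrow> (\<And>x. 0 < d x) \<Longrightarrow>
    (\<And>x. g x = (real (p x) - real (q x)) / real (d x)) \<Longrightarrow> ratf g"
  unfolding ratf_def by blast

lemma ratfE:
  assumes "ratf g"
  obtains p q d where "recf p" "recf q" "recf d" "\<And>x. 0 < d x"
    "\<And>x. g x = (real (p x) - real (q x)) / real (d x)"
  using assms unfolding ratf_def by blast

lemma ratf_real [rec_intros]: "recf f \<Longrightarrow> ratf (\<lambda>x. real (f x))"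
  by (rule ratfI[of f "\<lambda>x. 0" "\<lambda>x. 1"]) (simp_all add: recf_const)

lemma ratf_add [rec_intros]: "ratf f \<Longrightarrow> ratf g \<Longrightarrow> ratf (\<lambda>x. f x + g x)"
proof (elim ratfE)
  fix p q d p' q' d'
  assume [rec_intros]: "recf p" "recf q" "recf d" "recf p'" "recf q'" "recf d'"
    and *: "\<And>x. 0 < d x" "\<And>x. f x = (real (p x) - real (q x)) / real (d x)"
      "\<And>x. 0 < d' x" "\<And>x. g x = (real (p' x) - real (q' x)) / real (d' x)"
  show ?thesis
  proof (rule ratfI)
    show "recf (\<lambda>x. p x * d' x + p' x * d x)" "recf (\<lambda>x. q x * d' x + q' x * d x)"
      "recf (\<lambda>x. d x * d' x)" by (intro rec_intros)+
    show "f x + g x = (real (p x * d' x + p' x * d x) - real (q x * d' x + q' x * d x)) / real (d x * d' x)" for x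
      using *(1,3)[of x] unfolding *(2,4) by (simp add: field_simps)
  qed (use * in simp)
qed

lemma ratf_minus [rec_intros]: "ratf f \<Longrightarrow> ratf (\<lambda>x. - f x)"
proof (elim ratfE)
  fix p q d
  assume *: "recf p" "recf q" "recf d" "\<And>x. 0 < d x" "\<And>x. f x = (real (p x) - real (q x)) / real (d x)"
  then show ?thesis by (intro ratfI[of q p d]) (simp_all add: field_simps)
qed

lemma ratf_diff [rec_intros]: "ratf f \<Longrightarrow> ratf g \<Longrightarrow> ratf (\<lambda>x. f x - g x)"
  using ratf_add[OF _ ratf_minus, of f g] by simp

lemma ratf_mult [rec_intros]: "ratf f \<Longrightarrow> ratf g \<Longrightarrow> ratf (\<lambda>x. f x * g x)"
proof (elim ratfE)
  fix p q d p' q' d'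
  assume [rec_intros]: "recf p" "recf q" "recf d" "recf p'" "recf q'" "recf d'"
    and *: "\<And>x. 0 < d x" "\<And>x. f x = (real (p x) - real (q x)) / real (d x)"
      "\<And>x. 0 < d' x" "\<And>x. g x = (real (p' x) - real (q' x)) / real (d' x)"
  show ?thesis
  proof (rule ratfI)
    show "recf (\<lambda>x. p x * p' x + q x * q' x)" "recf (\<lambda>x. p x * q' x + q x * p' x)"
      "recf (\<lambda>x. d x * d' x)" by (intro rec_intros)+
    show "f x * g x = (real (p x * p' x + q x * q' x) - real (p x * q' x + q x * p' x)) / real (d x * d' x)" for x
      unfolding *(2,4) by (simp add: algebra_simps)
  qed (use * in simp)
qed

lemma sig1_ratf_less [rec_intros]: "ratf f \<Longrightarrow> ratf g \<Longrightarrow> sig1 (\<lambda>x. f x < g x)"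
  and sig1_ratf_le [rec_intros]: "ratf f \<Longrightarrow> ratf g \<Longrightarrow> sig1 (\<lambda>x. f x \<le> g x)"
proof -
  \<comment> \<open>Decidability is established first because the weak inequality is obtained by
    negating a strict one, which semidecidability would not permit.\<close>
  have *: "decp (\<lambda>x. f x < g x)" if "ratf f" "ratf g" for f g
  proof -
    from ratf_diff[OF that(2,1)] obtain p q d where pq: "recf p" "recf q" "\<And>x. 0 < d x"
      "\<And>x. g x - f x = (real (p x) - real (q x)) / real (d x)" by (rule ratfE) blast
    have "f x < g x \<longleftrightarrow> q x < p x" for x
    proof -
      have "f x < g x \<longleftrightarrow> 0 < g x - f x" by simp
      also have "\<dots> \<longleftrightarrow> q x < p x" unfolding pq(4) using pq(3)[of x] by (simp add: zero_less_divide_iff)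
      finally show ?thesis .
    qed
    then show ?thesis using pq(1,2) by (simp add: decp_less)
  qed
  then show "ratf f \<Longrightarrow> ratf g \<Longrightarrow> sig1 (\<lambda>x. f x < g x)" by (rule decp_sig1)
  have "decp (\<lambda>x. \<not> g x < f x)" if "ratf f" "ratf g"
    by (rule decp_not[OF *[OF that(2,1)]])
  then show "ratf f \<Longrightarrow> ratf g \<Longrightarrow> sig1 (\<lambda>x. f x \<le> g x)"
    by (intro decp_sig1) (simp add: not_less)
qed

lemma sig1_ratf_eq [rec_intros]: "ratf f \<Longrightarrow> ratf g \<Longrightarrow> sig1 (\<lambda>x. f x = g x)"
  unfolding eq_iff by (intro rec_intros)

section \<open>Decoding integers and rationals\<close>

lemma recf_half: "recf f \<Longrightarrow> recf (\<lambda>x. f x div 2)"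
proof -
  have "n div 2 = (LEAST k. n \<le> 2 * k + 1)" for n :: nat
    by (rule Least_equality[symmetric]) linarith+
  moreover have "recf (\<lambda>n. LEAST k. n \<le> 2 * k + 1)"
  proof (rule recf_LEAST)
    show "\<exists>k. n \<le> 2 * k + 1" for n :: nat
      by (rule exI[of _ n]) simp
  qed (intro rec_intros)
  ultimately have "recf (\<lambda>n. n div 2)" by presburger
  then show "recf f \<Longrightarrow> ?thesis" by (rule recf_comp)
qed

text \<open>The positive and negative parts of a coded integer: \<open>int_decode\<close> sends an
  even code \<open>2 * k\<close> to \<open>k\<close> and an odd code \<open>2 * k + 1\<close> to
  \<open>- k - 1\<close>.\<close>

definition ipos :: "nat \<Rightarrow> nat" where "ipos n = (if n = 2 * (n div 2) then n div 2 else 0)"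
definition ineg :: "nat \<Rightarrow> nat" where "ineg n = (if n = 2 * (n div 2) then 0 else Suc (n div 2))"

lemma int_decode_eq: "int_decode n = int (ipos n) - int (ineg n)"
proof -
  have "n = 2 * (n div 2) \<longleftrightarrow> even n" by presburger
  then show ?thesis
    by (simp add: int_decode_def sum_decode_def ipos_def ineg_def)
qed

lemma recf_ipos [rec_intros]: "recf f \<Longrightarrow> recf (\<lambda>x. ipos (f x))"
  and recf_ineg [rec_intros]: "recf f \<Longrightarrow> recf (\<lambda>x. ineg (f x))"
  unfolding ipos_def ineg_def by (intro rec_intros recf_half; assumption)+

text \<open>Codes with denominator 0 are no exception, since \<open>Fract a 0\<close> and real
  division by 0 are both 0.\<close>

lemma rat_code_eq:
  "rat_code c = real_of_int (int_decode (pfst c)) / real_of_int (int_decode (psnd c))"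
  by (cases "int_decode (psnd c) = 0")
    (simp_all add: nat_to_rat_surj_def case_prod_beta pfst_def psnd_def of_rat_rat rat_number_collapse)

lemma ratf_rat_code [rec_intros]:
  assumes "recf f"
  shows "ratf (\<lambda>x. rat_code (f x))"
proof -
  have "ratf rat_code"
  proof (rule ratfI)
    \<comment> \<open>A negative denominator is made positive by exchanging the two parts of the
      numerator; a zero denominator gives 0 over 1.\<close>
    let ?p = "\<lambda>c. if 0 < ineg (psnd c) then ineg (pfst c) else if 0 < ipos (psnd c) then ipos (pfst c) else 0"
    let ?q = "\<lambda>c. if 0 < ineg (psnd c) then ipos (pfst c) else if 0 < ipos (psnd c) then ineg (pfst c) else 0"
    let ?d = "\<lambda>c. if 0 < ineg (psnd c) then ineg (psnd c) else if 0 < ipos (psnd c) then ipos (psnd c) else 1"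
    show "recf ?p" "recf ?q" "recf ?d" by (intro rec_intros)+
    show "rat_code c = (real (?p c) - real (?q c)) / real (?d c)" for c
    proof -
      have "ipos (psnd c) = 0 \<or> ineg (psnd c) = 0" by (simp add: ipos_def ineg_def)
      then show ?thesis
        unfolding rat_code_eq int_decode_eq by (auto simp: field_simps)
    qed
  qed simp
  then obtain p q d where "recf p" "recf q" "recf d" "\<And>x. 0 < d x"
    "\<And>x. rat_code x = (real (p x) - real (q x)) / real (d x)" by (rule ratfE) blast
  then show ?thesis
    by (intro ratfI[of "\<lambda>x. p (f x)" "\<lambda>x. q (f x)" "\<lambda>x. d (f x)"]) (simp_all add: recf_comp assms)
qed

section \<open>Sequence spaces\<close>

lemma lpI: "summable (\<lambda>n. norm (f n) powr p) \<Longrightarrow> f \<in> lp p"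
  and lpD: "f \<in> lp p \<Longrightarrow> summable (\<lambda>n. norm (f n) powr p)"
  by (simp_all add: lp_def)

lemma lp_norm_nonneg [simp]: "0 \<le> lp_norm p f"
  by (simp add: lp_norm_def)

lemma lp_norm_powr:
  assumes "1 \<le> p" and "f \<in> lp p"
  shows "lp_norm p f powr p = (\<Sum>n. norm (f n) powr p)"
  using assms by (simp add: lp_norm_def powr_powr suminf_nonneg lpD)

lemma lp_norm_leI:
  assumes "1 \<le> p" and "f \<in> lp p" and "(\<Sum>n. norm (f n) powr p) \<le> c powr p" and "0 \<le> c"
  shows "lp_norm p f \<le> c"
proof -
  have "lp_norm p f \<le> (c powr p) powr (1 / p)"
    unfolding lp_norm_def using assms by (intro powr_mono2) (auto intro: suminf_nonneg lpD)
  then show ?thesis using assms by (simp add: powr_powr)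
qed

lemma lp_mono:
  assumes "1 \<le> p" and "g \<in> lp p" and le: "\<And>n. norm (f n) \<le> norm (g n)"
  shows "f \<in> lp p" and "lp_norm p f \<le> lp_norm p g"
proof -
  have le': "norm (f n) powr p \<le> norm (g n) powr p" for n
    using assms(1) le by (intro powr_mono2) auto
  show f: "f \<in> lp p"
    by (intro lpI summable_comparison_test'[OF lpD[OF assms(2)], of 0]) (use le' in simp)
  show "lp_norm p f \<le> lp_norm p g"
    unfolding lp_norm_def using assms(1)
    by (intro powr_mono2 suminf_le le' suminf_nonneg lpD f assms(2)) auto
qed

lemma norm_le_lp_norm:
  assumes "1 \<le> p" and "f \<in> lp p"
  shows "norm (f n) \<le> lp_norm p f"
proof -
  have "norm (f n) powr p \<le> (\<Sum>n. norm (f n) powr p)"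
    using sum_le_suminf[OF lpD[OF assms(2)], of "{n}"] by simp
  then have "(norm (f n) powr p) powr (1 / p) \<le> lp_norm p f"
    unfolding lp_norm_def using assms(1) by (intro powr_mono2) auto
  then show ?thesis using assms(1) by (simp add: powr_powr)
qed

lemma lp_norm_eq_0: "1 \<le> p \<Longrightarrow> f \<in> lp p \<Longrightarrow> lp_norm p f = 0 \<Longrightarrow> f n = 0"
  using norm_le_lp_norm[of p f n] by simp

text \<open>On positive arguments this is convexity of the power. If \<open>x\<close> or
  \<open>y\<close> is 0, it reduces to \<open>t powr p \<le> t\<close> for \<open>t\<close> between
  0 and 1.\<close>

lemma powr_convex_comb:
  fixes x y s :: real
  assumes "1 \<le> p" "0 \<le> x" "0 \<le> y" "0 < s" "s < 1"
  shows "(s * x + (1 - s) * y) powr p \<le> s * x powr p + (1 - s) * y powr p"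
proof -
  have le: "t powr p \<le> t" if "0 < t" "t < 1" for t :: real
    using powr_mono'[of 1 p t] that assms(1) by simp
  consider "x = 0" | "y = 0" | "0 < x" "0 < y" using assms by linarith
  then show ?thesis
  proof cases
    case 1
    then show ?thesis
      using assms le[of "1 - s"] by (simp add: powr_mult mult_right_mono)
  next
    case 2
    then show ?thesis
      using assms le[of s] by (simp add: powr_mult mult_right_mono)
  next
    case 3
    then show ?thesis
      using convex_onD[OF powr_convex[OF assms(1)], of "1 - s" x y] assms by simp
  qed
qed

text \<open>Minkowski's inequality by normalisation: \<open>f n + g n\<close> is
  \<open>a + b\<close> times the convex combination, with weight \<open>s = a / (a + b)\<close>, of
  the terms \<open>f n / a\<close> and \<open>g n / b\<close>. A vanishing norm is treated apart
  because of the division.\<close>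

lemma
  assumes p: "1 \<le> p" and f: "f \<in> lp p" and g: "g \<in> lp p"
  shows lp_add: "(\<lambda>n. f n + g n) \<in> lp p"
    and lp_norm_add: "lp_norm p (\<lambda>n. f n + g n) \<le> lp_norm p f + lp_norm p g"
proof -
  define a where "a = lp_norm p f"
  define b where "b = lp_norm p g"
  have "(\<lambda>n. f n + g n) \<in> lp p \<and> lp_norm p (\<lambda>n. f n + g n) \<le> a + b"
  proof (cases "a = 0 \<or> b = 0")
    case True
    then have "(\<forall>n. f n = 0) \<or> (\<forall>n. g n = 0)"
      using lp_norm_eq_0[OF p f] lp_norm_eq_0[OF p g] by (auto simp: a_def b_def)
    then show ?thesis
      using f g by (auto simp: a_def b_def)
  next
    case False
    then have ab: "0 < a" "0 < b"
      using lp_norm_nonneg[of p f] lp_norm_nonneg[of p g] by (auto simp: a_def b_def less_le)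
    define s where "s = a / (a + b)"
    have s: "0 < s" "s < 1" "1 - s = b / (a + b)"
      using ab by (auto simp: s_def field_simps)
    \<comment> \<open>A majorant obtained from convexity; its sum is exactly
      \<open>(a + b) powr p\<close>, because both normalised sequences have norm 1.\<close>
    define h where "h n = (a + b) powr p * (s * (norm (f n) powr p / a powr p) + (1 - s) * (norm (g n) powr p / b powr p))" for n
    have le: "norm (f n + g n) powr p \<le> h n" for n
    proof -
      have "norm (f n + g n) powr p \<le> (norm (f n) + norm (g n)) powr p"
        using p by (intro powr_mono2 norm_triangle_ineq) auto
      also have "norm (f n) + norm (g n) = (a + b) * (s * (norm (f n) / a) + (1 - s) * (norm (g n) / b))"
      proof -
        have "s * (x / a) = x / (a + b)" "(1 - s) * (x / b) = x / (a + b)" for x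
          unfolding s(3) unfolding s_def using ab by simp_all
        then show ?thesis using ab by (simp add: add_divide_distrib[symmetric])
      qed
      also have "\<dots> powr p = (a + b) powr p * (s * (norm (f n) / a) + (1 - s) * (norm (g n) / b)) powr p"
        by (rule powr_mult)
      also have "\<dots> \<le> (a + b) powr p * (s * (norm (f n) / a) powr p + (1 - s) * (norm (g n) / b) powr p)"
        using ab s p by (intro mult_left_mono powr_convex_comb) auto
      also have "\<dots> = h n"
        using ab by (simp add: h_def powr_divide)
      finally show ?thesis .
    qed
    have "(\<lambda>n. norm (f n) powr p) sums (a powr p)" "(\<lambda>n. norm (g n) powr p) sums (b powr p)"
      unfolding a_def b_def lp_norm_powr[OF p f] lp_norm_powr[OF p g]
      using lpD[OF f] lpD[OF g] by (simp_all add: summable_sums)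
    then have "h sums ((a + b) powr p * (s * (a powr p / a powr p) + (1 - s) * (b powr p / b powr p)))"
      unfolding h_def by (intro sums_mult sums_add sums_divide)
    then have h: "h sums ((a + b) powr p)" using ab by simp
    have in_lp: "(\<lambda>n. f n + g n) \<in> lp p"
      by (intro lpI summable_comparison_test'[OF sums_summable[OF h], of 0]) (use le in simp)
    have "(\<Sum>n. norm (f n + g n) powr p) \<le> (a + b) powr p"
      using suminf_le[OF le lpD[OF in_lp] sums_summable[OF h]] sums_unique[OF h] by simp
    then show ?thesis
      using in_lp ab by (intro conjI lp_norm_leI[OF p]) auto
  qed
  then show "(\<lambda>n. f n + g n) \<in> lp p" "lp_norm p (\<lambda>n. f n + g n) \<le> lp_norm p f + lp_norm p g"
    by (simp_all add: a_def b_def)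
qed

lemma lp_uminus: "f \<in> lp p \<Longrightarrow> (\<lambda>n. - f n) \<in> lp p"
  by (simp add: lp_def)

lemma lp_diff: "1 \<le> p \<Longrightarrow> f \<in> lp p \<Longrightarrow> g \<in> lp p \<Longrightarrow> (\<lambda>n. f n - g n) \<in> lp p"
  using lp_add[OF _ _ lp_uminus, of p f g] by simp

lemma lp_norm_diff: "1 \<le> p \<Longrightarrow> f \<in> lp p \<Longrightarrow> g \<in> lp p \<Longrightarrow>
    lp_norm p (\<lambda>n. f n - g n) \<le> lp_norm p f + lp_norm p g"
  using lp_norm_add[OF _ _ lp_uminus, of p f g] by (simp add: lp_norm_def)

lemma lp_zero: "(\<lambda>n. 0) \<in> lp p"
  by (simp add: lp_def)

lemma lp_scale: "f \<in> lp p \<Longrightarrow> (\<lambda>n. c * f n) \<in> lp p"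
  by (simp add: lp_def norm_mult powr_mult summable_mult)

lemma lp_sum: "1 \<le> p \<Longrightarrow> (\<And>i. i \<in> I \<Longrightarrow> f i \<in> lp p) \<Longrightarrow> (\<lambda>n. \<Sum>i\<in>I. f i n) \<in> lp p"
  by (induction I rule: infinite_finite_induct) (auto intro: lp_add lp_zero)

lemma lp_finite_supp:
  assumes "finite {n. f n \<noteq> 0}" and "1 \<le> p"
  shows "f \<in> lp p"
  unfolding lp_def using assms by (auto intro!: summable_finite[of "{n. f n \<noteq> 0}"])

text \<open>Mean value theorem; as \<open>p - 1\<close> is nonnegative, the derivative is bounded by
  its value at \<open>M\<close>. The derivative is used only to the right of \<open>b\<close>, which
  may be 0.\<close>

lemma powr_diff_le:
  fixes a b M :: real
  assumes "1 \<le> p" "0 \<le> b" "b \<le> a" "a \<le> M"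
  shows "a powr p - b powr p \<le> p * M powr (p - 1) * (a - b)"
proof (cases "b < a")
  case True
  have deriv: "((\<lambda>x. x powr p) has_real_derivative p * x powr (p - 1)) (at x)" if "b < x" for x
    using that assms by (intro has_real_derivative_powr) auto
  have cont: "continuous_on {b..a} (\<lambda>x. x powr p)"
    using assms by (intro continuous_on_powr' continuous_intros) auto
  obtain l z where z: "b < z" "z < a" "((\<lambda>x. x powr p) has_real_derivative l) (at z)"
    "a powr p - b powr p = (a - b) * l"
    using MVT[OF True cont] deriv real_differentiable_def by blast
  have l: "l = p * z powr (p - 1)"
    using DERIV_unique[OF z(3) deriv[OF z(1)]] .
  have "z powr (p - 1) \<le> M powr (p - 1)"
    using z assms by (intro powr_mono2) auto
  then have "(a - b) * (p * z powr (p - 1)) \<le> (a - b) * (p * M powr (p - 1))"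
    using assms by (intro mult_left_mono) auto
  then show ?thesis using z(4) by (simp add: l algebra_simps)
next
  case False
  then have "a = b" using assms by simp
  then show ?thesis by simp
qed

section \<open>Infinite dimension\<close>

text \<open>Applied to the first \<open>m + 1\<close> coordinates of \<open>m\<close> vectors, this
  yields a nonzero linear functional that vanishes on all of them.\<close>

lemma homogeneous_nontrivial_solution:
  fixes A :: "nat \<Rightarrow> nat \<Rightarrow> complex"
  shows "\<exists>x. (\<exists>j\<le>m. x j \<noteq> 0) \<and> (\<forall>i<m. (\<Sum>j\<le>m. A i j * x j) = 0)"
proof (induction m arbitrary: A)
  case 0
  then show ?case by (intro exI[of _ "\<lambda>_. 1"]) simp
next
  case (Suc m)
  show ?case
  proof (cases "\<forall>i\<le>m. A i (Suc m) = 0")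
    case True
    show ?thesis
      by (rule exI[of _ "\<lambda>j. if j = Suc m then 1 else 0"])
        (use True in \<open>auto simp: if_distrib[of "(*) _"] less_Suc_eq_le cong: if_cong\<close>)
  next
    case False
    then obtain k where k: "k \<le> m" "A k (Suc m) \<noteq> 0" by blast
    \<comment> \<open>Gaussian elimination of the last unknown; \<open>r\<close> enumerates the rows other than \<open>k\<close>.\<close>
    define r where "r i = (if i < k then i else Suc i)" for i
    define B where "B i j = A (r i) j - A (r i) (Suc m) / A k (Suc m) * A k j" for i j
    obtain x where x: "\<exists>j\<le>m. x j \<noteq> 0" "\<forall>i<m. (\<Sum>j\<le>m. B i j * x j) = 0"
      using Suc.IH[of B] by blast
    define s where "s i = (\<Sum>j\<le>m. A i j * x j)" for i
    define y where "y j = (if j = Suc m then - s k / A k (Suc m) else x j)" for j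
    have sum: "(\<Sum>j\<le>Suc m. A i j * y j) = s i - A i (Suc m) * s k / A k (Suc m)" for i
      by (simp add: y_def s_def)
    have "s (r i) - A (r i) (Suc m) * s k / A k (Suc m) = 0" if "i < m" for i
    proof -
      have "(\<Sum>j\<le>m. B i j * x j) = s (r i) - A (r i) (Suc m) / A k (Suc m) * s k"
        unfolding B_def s_def by (simp add: left_diff_distrib sum_subtractf sum_distrib_left mult.assoc)
      then show ?thesis using x(2) that by simp
    qed
    moreover have "\<exists>i'<m. i = r i'" if "i \<le> m" "i \<noteq> k" for i
      using that k(1) by (intro exI[of _ "if i < k then i else i - 1"]) (auto simp: r_def)
    ultimately have "s i - A i (Suc m) * s k / A k (Suc m) = 0" if "i \<le> m" for i
      using that k(2) by (cases "i = k") auto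
    then have "\<forall>i<Suc m. (\<Sum>j\<le>Suc m. A i j * y j) = 0"
      unfolding sum by (simp add: less_Suc_eq_le)
    moreover from x(1) obtain j where "j \<le> m" "x j \<noteq> 0" by blast
    then have "j \<le> Suc m" "y j \<noteq> 0" by (simp_all add: y_def)
    ultimately show ?thesis by blast
  qed
qed

text \<open>Were \<open>A\<close> to have \<open>m\<close> elements, some nonzero \<open>x\<close>
  on the coordinates up to \<open>m\<close> would annihilate its span. The conjugate
  \<open>f\<close> of \<open>x\<close> is paired with \<open>x\<close> to \<open>N > 0\<close>,
  whereas a vector \<open>d\<close> is paired to at most \<open>L\<close> times its norm; so
  \<open>f\<close> has distance at least \<open>N / L\<close> from the span.\<close>

lemma linearly_dense_infinite:
  assumes p: "1 \<le> p" and "A \<subseteq> lp p" and dense: "linearly_dense p A"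
  shows "infinite A"
proof
  assume "finite A"
  then obtain h where h: "bij_betw h {..<card A} A"
    using ex_bij_betw_nat_finite atLeast0LessThan by metis
  define m where "m = card A"
  obtain x where x: "\<exists>j\<le>m. x j \<noteq> 0" "\<forall>i<m. (\<Sum>j\<le>m. h i j * x j) = 0"
    using homogeneous_nontrivial_solution[of m h] by blast
  define f where "f j = (if j \<le> m then cnj (x j) else 0)" for j
  have f: "f \<in> lp p"
    by (rule lp_finite_supp[OF finite_subset[of _ "{..m}"] p]) (auto simp: f_def)
  define N where "N = (\<Sum>j\<le>m. (norm (x j))\<^sup>2)"
  define L where "L = (\<Sum>j\<le>m. norm (x j))"
  from x(1) obtain j0 where "j0 \<le> m" "x j0 \<noteq> 0" by blast
  then have N: "0 < N" and L: "0 < L"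
    unfolding N_def L_def by (auto intro!: sum_pos2[of _ j0])
  obtain T a where T: "finite T" "T \<subseteq> A" and close: "lp_norm p (\<lambda>n. f n - (\<Sum>g\<in>T. a g * g n)) < N / L"
    using dense f N L unfolding linearly_dense_def by (meson divide_pos_pos)
  define d where "d n = f n - (\<Sum>g\<in>T. a g * g n)" for n
  have "d \<in> lp p"
    unfolding d_def using T assms(2) by (intro lp_diff lp_sum lp_scale p f) auto
  have "(\<Sum>j\<le>m. g j * x j) = 0" if "g \<in> T" for g
  proof -
    from that T(2) h obtain i where "i < m" "g = h i"
      unfolding bij_betw_def m_def by blast
    with x(2) show ?thesis by blast
  qed
  then have "(\<Sum>j\<le>m. (\<Sum>g\<in>T. a g * g j) * x j) = 0"
    by (simp add: sum_distrib_right sum.swap[of _ T] mult.assoc flip: sum_distrib_left)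
  moreover have "(\<Sum>j\<le>m. f j * x j) = of_real N"
    unfolding N_def of_real_sum complex_norm_square by (simp add: f_def mult.commute)
  ultimately have "(\<Sum>j\<le>m. d j * x j) = of_real N"
    by (simp add: d_def left_diff_distrib sum_subtractf)
  then have "N = norm (\<Sum>j\<le>m. d j * x j)"
    using N by simp
  also have "\<dots> \<le> (\<Sum>j\<le>m. lp_norm p d * norm (x j))"
    using norm_le_lp_norm[OF p \<open>d \<in> lp p\<close>]
    by (intro order_trans[OF norm_sum] sum_mono) (simp add: norm_mult mult_right_mono)
  also have "\<dots> = lp_norm p d * L"
    by (simp add: L_def sum_distrib_left)
  also have "\<dots> < N"
    using close L by (simp add: d_def[abs_def] pos_less_divide_eq)
  finally show False by simp
qed

section \<open>Disintegrations\<close>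

locale lp_disintegration =
  fixes p :: real and S :: "nat list set" and \<phi> :: "nat list \<Rightarrow> nat \<Rightarrow> complex"
  assumes p1: "1 \<le> p" and disint: "disintegration p S \<phi>"
begin

lemma children_subset: "children S \<nu> \<subseteq> S"
  by (auto simp: children_def)

lemma children_inc: "\<mu> \<in> children S \<nu> \<Longrightarrow> \<nu> \<in> S"
  using disint by (auto simp: children_def disintegration_def is_tree_def)

lemma in_lp: "\<nu> \<in> S \<Longrightarrow> \<phi> \<nu> \<in> lp p"
  using disint by (auto simp: disintegration_def)

lemma siblings_disjoint:
  assumes "\<mu> \<in> children S \<nu>" "\<mu>' \<in> children S \<nu>" "\<mu> \<noteq> \<mu>'" "\<phi> \<mu> n \<noteq> 0"
  shows "\<phi> \<mu>' n = 0"
proof -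
  have "\<mu> \<parallel> \<mu>'"
    using assms(1-3) by (auto simp: children_def parallel_def)
  then have "supp (\<phi> \<mu>) \<inter> supp (\<phi> \<mu>') = {}"
    using disint assms(1,2) children_subset unfolding disintegration_def separating_def by blast
  then show ?thesis
    using assms(4) by (auto simp: supp_def)
qed

lemma rest_in_lp:
  assumes "\<nu> \<in> S" "\<And>i. i \<in> I \<Longrightarrow> g i \<in> S"
  shows "(\<lambda>n. \<phi> \<nu> n - (\<Sum>i\<in>I. \<phi> (g i) n)) \<in> lp p"
  using assms by (intro lp_diff lp_sum p1 in_lp)

text \<open>The given child certifies that \<open>\<nu>\<close> is a nonterminal node, which is what
  summativity asks for.\<close>

lemma sum_close:
  assumes "\<mu> \<in> children S \<nu>" "0 < e"
  obtains X where "finite X" "X \<subseteq> children S \<nu>"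
    "\<And>Y. finite Y \<Longrightarrow> X \<subseteq> Y \<Longrightarrow> Y \<subseteq> children S \<nu> \<Longrightarrow> lp_norm p (\<lambda>n. \<phi> \<nu> n - (\<Sum>i\<in>Y. \<phi> i n)) < e"
proof -
  have "lp_has_sum p \<phi> (\<phi> \<nu>) (children S \<nu>)"
    using disint children_inc[OF assms(1)] assms(1)
    by (auto simp: disintegration_def summative_def terminal_def)
  then have "eventually (\<lambda>Y. lp_norm p (\<lambda>n. \<phi> \<nu> n - (\<Sum>i\<in>Y. \<phi> i n)) < e) (finite_subsets_at_top (children S \<nu>))"
    unfolding lp_has_sum_def using assms(2) by (rule order_tendstoD)
  then obtain X where "finite X" "X \<subseteq> children S \<nu>" "\<forall>Y. finite Y \<and> X \<subseteq> Y \<and> Y \<subseteq> children S \<nu> \<longrightarrow>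
      lp_norm p (\<lambda>n. \<phi> \<nu> n - (\<Sum>i\<in>Y. \<phi> i n)) < e"
    unfolding eventually_finite_subsets_at_top by blast
  then show thesis by (intro that[of X]) simp_all
qed

text \<open>Convergence in norm implies convergence of each coordinate, and at a coordinate in the
  support of \<open>\<phi> \<mu>\<close> every finite partial sum that includes \<open>\<mu>\<close>
  already has the value of \<open>\<phi> \<mu>\<close>.\<close>

lemma child_value:
  assumes "\<mu> \<in> children S \<nu>" "\<phi> \<mu> n \<noteq> 0"
  shows "\<phi> \<nu> n = \<phi> \<mu> n"
proof (rule ccontr)
  assume "\<phi> \<nu> n \<noteq> \<phi> \<mu> n"
  then have "0 < norm (\<phi> \<nu> n - \<phi> \<mu> n)" by simp
  from sum_close[OF assms(1) this] obtain X where X: "finite X" "X \<subseteq> children S \<nu>"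
    "\<And>Y. finite Y \<Longrightarrow> X \<subseteq> Y \<Longrightarrow> Y \<subseteq> children S \<nu> \<Longrightarrow>
      lp_norm p (\<lambda>n. \<phi> \<nu> n - (\<Sum>i\<in>Y. \<phi> i n)) < norm (\<phi> \<nu> n - \<phi> \<mu> n)" by metis
  define Y where "Y = insert \<mu> X"
  have Y: "finite Y" "X \<subseteq> Y" "Y \<subseteq> children S \<nu>" "\<mu> \<in> Y"
    using X(1,2) assms(1) by (auto simp: Y_def)
  have "(\<Sum>i\<in>Y. \<phi> i n) = (\<Sum>i\<in>{\<mu>}. \<phi> i n)"
    using Y siblings_disjoint[OF assms(1) _ _ assms(2)] by (intro sum.mono_neutral_right) auto
  then have "norm (\<phi> \<nu> n - \<phi> \<mu> n) \<le> lp_norm p (\<lambda>n. \<phi> \<nu> n - (\<Sum>i\<in>Y. \<phi> i n))"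
    using norm_le_lp_norm[OF p1 rest_in_lp[of \<nu> Y id], of n] Y(3) children_subset children_inc[OF assms(1)]
    by auto
  with X(3)[OF Y(1-3)] show False by simp
qed

text \<open>The domination is pointwise: on the support of \<open>\<phi> \<mu>\<close> the
  subtracted terms vanish and \<open>\<phi> \<nu>\<close> agrees with \<open>\<phi> \<mu>\<close>.
  The \<open>c i\<close> may repeat, so a certificate need not check that its children are
  distinct.\<close>

lemma child_norm_le_rest:
  fixes m :: nat
  assumes "\<mu> \<in> children S \<nu>" and "\<And>i. i < m \<Longrightarrow> c i \<in> children S \<nu> \<and> c i \<noteq> \<mu>"
  shows "lp_norm p (\<phi> \<mu>) \<le> lp_norm p (\<lambda>n. \<phi> \<nu> n - (\<Sum>i<m. \<phi> (c i) n))"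
proof (rule lp_mono(2)[OF p1 rest_in_lp])
  show "norm (\<phi> \<mu> n) \<le> norm (\<phi> \<nu> n - (\<Sum>i<m. \<phi> (c i) n))" for n
  proof (cases "\<phi> \<mu> n = 0")
    case False
    then have "(\<Sum>i<m. \<phi> (c i) n) = 0"
      using assms siblings_disjoint[OF assms(1) _ _ False] by (intro sum.neutral) auto
    then show ?thesis
      using child_value[OF assms(1) False] by simp
  qed simp
qed (use assms children_inc children_subset in blast)+

lemma norm_le_root: "\<nu> \<in> S \<Longrightarrow> lp_norm p (\<phi> \<nu>) \<le> lp_norm p (\<phi> [])"
proof (induction \<nu> rule: rev_induct)
  case (snoc k \<nu>)
  then have "\<nu> @ [k] \<in> children S \<nu>" by (auto simp: children_def)
  then show ?case
    \<comment> \<open>With no subtracted child, the rest is \<open>\<phi> \<nu>\<close>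
      itself.\<close>
    using child_norm_le_rest[of "\<nu> @ [k]" \<nu> 0] snoc.IH children_inc by fastforce
qed simp

lemma norm_pos:
  assumes "\<nu> \<in> S"
  shows "0 < lp_norm p (\<phi> \<nu>)"
proof -
  have "\<phi> \<nu> \<noteq> (\<lambda>_. 0)"
    using disint assms by (auto simp: disintegration_def)
  then have "lp_norm p (\<phi> \<nu>) \<noteq> 0"
    using lp_norm_eq_0[OF p1 in_lp[OF assms]] by blast
  then show ?thesis
    using lp_norm_nonneg[of p "\<phi> \<nu>"] by linarith
qed

lemma ex_other_child:
  assumes "\<tau> \<in> children S \<nu>"
  shows "\<exists>\<sigma>\<in>children S \<nu>. \<sigma> \<noteq> \<tau>"
proof (rule ccontr)
  assume "\<not> ?thesis"
  with assms have single: "children S \<nu> = {\<tau>}" by blast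
  have "\<nu> \<in> S" "\<tau> \<in> S" "\<nu> \<noteq> \<tau>"
    using children_inc[OF assms] assms by (auto simp: children_def)
  have diff: "(\<lambda>n. \<phi> \<nu> n - \<phi> \<tau> n) \<in> lp p"
    by (intro lp_diff p1 in_lp) fact+
  have "lp_norm p (\<lambda>n. \<phi> \<nu> n - \<phi> \<tau> n) < e" if e: "0 < e" for e
  proof -
    obtain X where "\<And>Y. finite Y \<Longrightarrow> X \<subseteq> Y \<Longrightarrow> Y \<subseteq> children S \<nu> \<Longrightarrow>
        lp_norm p (\<lambda>n. \<phi> \<nu> n - (\<Sum>i\<in>Y. \<phi> i n)) < e" "X \<subseteq> children S \<nu>"
      using sum_close[OF assms e] by metis
    from this(1)[of "{\<tau>}"] this(2) show ?thesis by (simp add: single)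
  qed
  then have "lp_norm p (\<lambda>n. \<phi> \<nu> n - \<phi> \<tau> n) = 0"
    using lp_norm_nonneg[of p "\<lambda>n. \<phi> \<nu> n - \<phi> \<tau> n"] by (metis less_irrefl order_le_less)
  then have "\<phi> \<nu> = \<phi> \<tau>"
    using lp_norm_eq_0[OF p1 diff] by (intro ext) simp
  then show False
    using disint \<open>\<nu> \<in> S\<close> \<open>\<tau> \<in> S\<close> \<open>\<nu> \<noteq> \<tau>\<close> by (auto simp: disintegration_def inj_on_def)
qed

text \<open>The finite set of children is indexed by an initial segment of the naturals, the form in
  which coded lists supply children.\<close>

lemma rest_small:
  assumes "\<mu> \<in> children S \<nu>" "0 < e"
  obtains m :: nat and c where "\<And>i. i < m \<Longrightarrow> c i \<in> children S \<nu>"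
    "lp_norm p (\<lambda>n. \<phi> \<nu> n - (\<Sum>i<m. \<phi> (c i) n)) < e"
proof -
  obtain X where X: "finite X" "X \<subseteq> children S \<nu>" "lp_norm p (\<lambda>n. \<phi> \<nu> n - (\<Sum>i\<in>X. \<phi> i n)) < e"
    using sum_close[OF assms] by (metis order_refl)
  obtain c where c: "bij_betw c {..<card X} X"
    using ex_bij_betw_nat_finite[OF X(1)] atLeast0LessThan by metis
  show thesis
  proof (rule that)
    show "c i \<in> children S \<nu>" if "i < card X" for i
      using c X(2) that by (auto simp: bij_betw_def)
    show "lp_norm p (\<lambda>n. \<phi> \<nu> n - (\<Sum>i<card X. \<phi> (c i) n)) < e"
      using X(3) sum.reindex_bij_betw[OF c, of "\<lambda>i. \<phi> i _"] by simp
  qed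
qed

text \<open>Even among infinitely many children the supremum is attained: remove finitely many
  children so that the rest is smaller in norm than one fixed child. All other children are
  dominated by this rest, so a maximum over a finite set suffices.\<close>

lemma ex_max_child:
  assumes "\<not> terminal S \<nu>"
  obtains \<mu> where "\<mu> \<in> children S \<nu>" "\<And>\<tau>. \<tau> \<in> children S \<nu> \<Longrightarrow> lp_norm p (\<phi> \<tau>) \<le> lp_norm p (\<phi> \<mu>)"
proof -
  obtain \<mu> where \<mu>: "\<mu> \<in> children S \<nu>"
    using assms by (auto simp: terminal_def)
  then have "0 < lp_norm p (\<phi> \<mu>)"
    using norm_pos children_subset by blast
  from rest_small[OF \<mu> this] obtain m :: nat and c where c: "\<And>i. i < m \<Longrightarrow> c i \<in> children S \<nu>"
    "lp_norm p (\<lambda>n. \<phi> \<nu> n - (\<Sum>i<m. \<phi> (c i) n)) < lp_norm p (\<phi> \<mu>)" by metis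
  define X where "X = insert \<mu> (c ` {..<m})"
  have X: "finite X" "X \<noteq> {}" "X \<subseteq> children S \<nu>"
    using \<mu> c(1) by (auto simp: X_def)
  have "Max ((\<lambda>\<tau>. lp_norm p (\<phi> \<tau>)) ` X) \<in> (\<lambda>\<tau>. lp_norm p (\<phi> \<tau>)) ` X"
    using X(1,2) by (intro Max_in) auto
  then obtain \<sigma> where \<sigma>: "\<sigma> \<in> X" "Max ((\<lambda>\<tau>. lp_norm p (\<phi> \<tau>)) ` X) = lp_norm p (\<phi> \<sigma>)" by blast
  have \<sigma>_max: "lp_norm p (\<phi> \<tau>) \<le> lp_norm p (\<phi> \<sigma>)" if "\<tau> \<in> X" for \<tau>
    unfolding \<sigma>(2)[symmetric] using X(1) that by (intro Max_ge) auto
  have "lp_norm p (\<phi> \<tau>) \<le> lp_norm p (\<phi> \<sigma>)" if \<tau>: "\<tau> \<in> children S \<nu>" for \<tau>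
  proof (cases "\<tau> \<in> X")
    case False
    then have "lp_norm p (\<phi> \<tau>) \<le> lp_norm p (\<lambda>n. \<phi> \<nu> n - (\<Sum>i<m. \<phi> (c i) n))"
      using c(1) by (intro child_norm_le_rest[OF \<tau>]) (auto simp: X_def)
    then show ?thesis
      using c(2) \<sigma>_max[of \<mu>] by (simp add: X_def)
  qed (rule \<sigma>_max)
  then show thesis
    using that \<sigma>(1) X(3) by blast
qed

lemma infinite_tree: "infinite S"
  using linearly_dense_infinite[OF p1, of "\<phi> ` S"] disint
  by (auto simp: disintegration_def)

end

section \<open>Chains from a choice of children\<close>

text \<open>The combinatorial part, free of norms and computability. The selection is a relation
  because nothing is selected at terminal nodes; the chains are then the forward orbits under
  \<open>r\<^sup>*\<close>.\<close>

locale child_selection =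
  fixes S :: "nat list set" and r :: "(nat list \<times> nat list) set"
  assumes tree: "is_tree S" and inf: "infinite S"
    and other_child: "\<And>\<nu> \<tau>. \<tau> \<in> children S \<nu> \<Longrightarrow> \<exists>\<sigma>\<in>children S \<nu>. \<sigma> \<noteq> \<tau>"
    and sel_child: "\<And>\<nu> \<tau>. (\<nu>, \<tau>) \<in> r \<Longrightarrow> \<tau> \<in> children S \<nu>"
    and sel_unique: "single_valued r"
    and sel_ex: "\<And>\<nu>. \<nu> \<in> S \<Longrightarrow> \<not> terminal S \<nu> \<Longrightarrow> \<exists>\<tau>. (\<nu>, \<tau>) \<in> r"
begin

definition roots :: "nat list set" where "roots = S - Range r"

lemma selD:
  assumes "(\<nu>, \<tau>) \<in> r"
  shows "\<tau> \<in> S" and "butlast \<tau> = \<nu>" and "prefix \<nu> \<tau>"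
  using sel_child[OF assms] by (auto simp: children_def)

lemma parent_unique: "single_valued (r\<inverse>)"
  using selD(2) by (auto simp: single_valued_def)

text \<open>Replaces the negative condition of not being selected by a positive, hence semidecidable
  one. The parent of a nonempty node is nonterminal, so it has a selected child, and by uniqueness a
  node other than this child is not selected.\<close>

lemma roots_eq: "roots = {\<rho>\<in>S. \<rho> = [] \<or> (\<exists>\<sigma> \<tau>. (\<sigma>, \<tau>) \<in> r \<and> (\<exists>k. \<rho> = \<sigma> @ [k]) \<and> \<rho> \<noteq> \<tau>)}"
proof (intro equalityI subsetI)
  fix \<rho> assume \<rho>: "\<rho> \<in> roots"
  show "\<rho> \<in> {\<rho>\<in>S. \<rho> = [] \<or> (\<exists>\<sigma> \<tau>. (\<sigma>, \<tau>) \<in> r \<and> (\<exists>k. \<rho> = \<sigma> @ [k]) \<and> \<rho> \<noteq> \<tau>)}"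
  proof (cases \<rho> rule: rev_cases)
    case (snoc \<sigma> k)
    then have "\<rho> \<in> children S \<sigma>" using \<rho> by (auto simp: roots_def children_def)
    moreover from this have "\<sigma> \<in> S"
      using tree by (auto simp: children_def is_tree_def)
    ultimately obtain \<tau> where "(\<sigma>, \<tau>) \<in> r"
      using sel_ex by (auto simp: terminal_def)
    then show ?thesis using \<rho> snoc by (auto simp: roots_def)
  qed (use \<rho> in \<open>auto simp: roots_def\<close>)
next
  fix \<rho> assume "\<rho> \<in> {\<rho>\<in>S. \<rho> = [] \<or> (\<exists>\<sigma> \<tau>. (\<sigma>, \<tau>) \<in> r \<and> (\<exists>k. \<rho> = \<sigma> @ [k]) \<and> \<rho> \<noteq> \<tau>)}"
  moreover have "\<rho> \<noteq> []" and "(\<sigma>, \<rho>) \<in> r" if "\<rho> \<in> Range r" "\<rho> = \<sigma> @ [k]" for \<sigma> k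
    using that selD(2) by fastforce+
  moreover have "[] \<notin> Range r"
    using sel_child by (auto simp: children_def)
  ultimately show "\<rho> \<in> roots"
    using sel_unique unfolding roots_def single_valued_def by blast
qed

lemma ex_root: "\<nu> \<in> S \<Longrightarrow> \<exists>\<rho>\<in>roots. (\<rho>, \<nu>) \<in> r\<^sup>*"
proof (induction \<nu> rule: length_induct)
  case (1 \<nu>)
  show ?case
  proof (cases "\<nu> \<in> roots")
    case False
    then obtain \<sigma> where \<sigma>: "(\<sigma>, \<nu>) \<in> r" using 1 by (auto simp: roots_def)
    then have "\<sigma> \<in> S" "length \<sigma> < length \<nu>"
      using sel_child[OF \<sigma>] tree by (auto simp: children_def is_tree_def)
    with 1 \<sigma> show ?thesis by (meson rtrancl_into_rtrancl)
  qed blast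
qed

text \<open>Each node has at most one predecessor under \<open>r\<close>, so of two ancestors of
  \<open>\<nu>\<close> one is an ancestor of the other; a root has no predecessor.\<close>

lemma root_unique:
  assumes "\<rho> \<in> roots" "\<rho>' \<in> roots" "(\<rho>, \<nu>) \<in> r\<^sup>*" "(\<rho>', \<nu>) \<in> r\<^sup>*"
  shows "\<rho> = \<rho>'"
proof -
  have "(\<rho>, \<rho>') \<in> r\<^sup>* \<or> (\<rho>', \<rho>) \<in> r\<^sup>*"
    using single_valued_confluent[OF parent_unique, of \<nu> \<rho> \<rho>'] assms(3,4)
    by (auto simp: rtrancl_converse)
  then show ?thesis
    using assms(1,2) by (auto simp: roots_def elim: rtranclE)
qed

lemma rtrancl_prefix: "(\<mu>, \<nu>) \<in> r\<^sup>* \<Longrightarrow> prefix \<mu> \<nu>"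
  by (induction rule: rtrancl_induct) (simp, metis selD(3) prefix_order.trans)

lemma rtrancl_tree: "(\<rho>, \<nu>) \<in> r\<^sup>* \<Longrightarrow> \<rho> \<in> S \<Longrightarrow> \<nu> \<in> S"
  by (induction rule: rtrancl_induct) (auto dest: selD(1))

lemma chain: "is_chain (r\<^sup>* `` {\<rho>})"
  unfolding is_chain_def using single_valued_confluent[OF sel_unique] rtrancl_prefix by blast

text \<open>A nonterminal node has a selected child and another child, which is a root. So there are at
  least as many roots as nonterminal nodes, and at least as many nonterminal nodes as nodes that
  are not roots.\<close>

lemma infinite_roots: "infinite roots"
proof
  assume fin: "finite roots"
  have "\<exists>\<sigma>\<in>roots. butlast \<sigma> = \<nu>" if "\<nu> \<in> Domain r" for \<nu>
  proof -
    from that obtain \<tau> where \<tau>: "(\<nu>, \<tau>) \<in> r" by blast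
    then obtain \<sigma> where \<sigma>: "\<sigma> \<in> children S \<nu>" "\<sigma> \<noteq> \<tau>"
      using other_child sel_child by blast
    then have "\<sigma> \<in> roots" "butlast \<sigma> = \<nu>"
      unfolding roots_eq using \<tau> by (auto simp: children_def)
    then show ?thesis by blast
  qed
  then have "Domain r \<subseteq> butlast ` roots" by blast
  with fin have "finite (Domain r)" by (meson finite_imageI finite_subset)
  moreover have "inj_on butlast (Range r)"
  proof (rule inj_onI)
    fix \<tau> \<tau>' assume "\<tau> \<in> Range r" "\<tau>' \<in> Range r" "butlast \<tau> = butlast \<tau>'"
    then obtain \<nu> where "(\<nu>, \<tau>) \<in> r" "(\<nu>, \<tau>') \<in> r"
      using selD(2) by (metis RangeE)
    then show "\<tau> = \<tau>'" using sel_unique by (auto simp: single_valued_def)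
  qed
  moreover have "butlast ` Range r \<subseteq> Domain r"
    using selD(2) by auto
  ultimately have "finite (Range r)" by (meson finite_imageD finite_subset)
  with fin have "finite (roots \<union> Range r)" by simp
  moreover have "S \<subseteq> roots \<union> Range r" by (auto simp: roots_def)
  ultimately show False using inf finite_subset by blast
qed

end

section \<open>Computing norms\<close>

lemma gauss_code_eq: "gauss_code c = Complex (rat_code (pfst c)) (rat_code (psnd c))"
  by (simp add: gauss_code_def pfst_def psnd_def case_prod_beta)

lemma ex_rat_code_between:
  fixes a b :: real
  assumes "a < b"
  obtains c where "a < rat_code c" "rat_code c < b"
proof -
  obtain q :: real where "q \<in> \<rat>" "a < q" "q < b" using Rats_dense_in_real[OF assms] by blast
  moreover from this(1) obtain c where "q = rat_code c" using surj_of_rat_nat_to_rat_surj by blast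
  ultimately show thesis using that by blast
qed

section \<open>Arithmetic of coded rational vectors\<close>

lemma ex_gauss_code_diff: "\<exists>d. gauss_code e = gauss_code d + gauss_code c"
proof -
  have "\<exists>d. rat_code d = rat_code e - rat_code c" for e c
    using surj_nat_to_rat_surj by (metis of_rat_diff surjD)
  then obtain a b where "rat_code a = rat_code (pfst e) - rat_code (pfst c)"
    "rat_code b = rat_code (psnd e) - rat_code (psnd c)" by meson
  then show ?thesis
    by (intro exI[of _ "prod_encode (a, b)"]) (simp add: gauss_code_eq complex_eq_iff)
qed

lemma gauss_code_0 [simp]: "gauss_code 0 = 0"
  by (simp add: gauss_code_eq rat_code_eq int_decode_eq ipos_def ineg_def complex_eq_iff)

lemma cnth_beyond: "clen l \<le> i \<Longrightarrow> cnth l i = 0"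
  by (simp add: cnth_def clen_def)

text \<open>Padding with zero coefficients gives vectors of different lengths a common range of
  summation.\<close>

lemma rat_vec_eq:
  assumes "clen c \<le> L"
  shows "rat_vec R c n = (\<Sum>j<L. gauss_code (cnth c j) * R j n)"
proof -
  have "rat_vec R c n = (\<Sum>j<clen c. gauss_code (cnth c j) * R j n)"
    by (simp add: rat_vec_def clen_def cnth_def)
  also have "\<dots> = (\<Sum>j<L. gauss_code (cnth c j) * R j n)"
    using assms by (intro sum.mono_neutral_left) (auto simp: cnth_beyond)
  finally show ?thesis .
qed

text \<open>Subtraction \<open>d = e - c\<close> as a relation: a code of the difference is searched
  for instead of being computed. The bound exceeds the lengths of all three lists, and beyond it
  every coefficient is 0.\<close>

definition vadd :: "nat \<Rightarrow> nat \<Rightarrow> nat \<Rightarrow> bool" where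
  "vadd d c e \<longleftrightarrow> (\<forall>i<d + c + e. gauss_code (cnth e i) = gauss_code (cnth d i) + gauss_code (cnth c i))"

lemma vadd_iff: "vadd d c e \<longleftrightarrow> (\<forall>i. gauss_code (cnth e i) = gauss_code (cnth d i) + gauss_code (cnth c i))"
proof -
  have "gauss_code (cnth e i) = gauss_code (cnth d i) + gauss_code (cnth c i)" if "d + c + e \<le> i" for i
    using that clen_le[of d] clen_le[of c] clen_le[of e] by (simp add: cnth_beyond)
  then show ?thesis unfolding vadd_def by (meson not_less)
qed

lemma vadd_rat_vec: "vadd d c e \<Longrightarrow> rat_vec R e n = rat_vec R d n + rat_vec R c n"
  using rat_vec_eq[of e "clen e + clen d + clen c"] rat_vec_eq[of d "clen e + clen d + clen c"]
    rat_vec_eq[of c "clen e + clen d + clen c"]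
  by (simp add: vadd_iff distrib_right sum.distrib)

lemma ex_vadd: "\<exists>d. vadd d c e"
proof -
  obtain g where g: "\<And>i. gauss_code (cnth e i) = gauss_code (g i) + gauss_code (cnth c i)"
    using choice[OF allI[OF ex_gauss_code_diff]] by blast
  obtain d where d: "clen d = clen c + clen e" "\<forall>i<clen c + clen e. cnth d i = g i"
    using ex_cnth[of "clen c + clen e" g] by blast
  have "gauss_code (cnth e i) = gauss_code (cnth d i) + gauss_code (cnth c i)" for i
    using d g by (cases "i < clen c + clen e") (simp_all add: cnth_beyond)
  then show ?thesis unfolding vadd_iff by blast
qed

lemma sig1_vadd [rec_intros]:
  assumes "recf f" "recf g" "recf h"
  shows "sig1 (\<lambda>x. vadd (f x) (g x) (h x))"
  unfolding vadd_def gauss_code_eq complex_eq_iff plus_complex.simps complex.sel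
  by (intro rec_intros recf_comp[OF assms(1)] recf_comp[OF assms(2)] recf_comp[OF assms(3)])

lemma rat_vec_in_lp:
  assumes "1 \<le> p" "range R \<subseteq> lp p"
  shows "rat_vec R c \<in> lp p"
  unfolding rat_vec_def using assms by (intro lp_sum lp_scale) auto

text \<open>\<open>A\<close> enumerates rational balls around \<open>f w\<close>, among them
  arbitrarily small ones, and \<open>X\<close> singles out the meaningful inputs \<open>w\<close>. A
  complex ball returned for such a ball contains the norm, so the real part of its centre plus or
  minus its radius bounds the norm; small balls make these bounds arbitrarily sharp.\<close>

lemma sig1_norm_bounds:
  fixes f :: "nat \<Rightarrow> nat \<Rightarrow> complex"
  assumes pres: "computable_presentation p R"
    and A: "sig1 (\<lambda>z. A (pfst z) (psnd z))"
    and in_lp: "\<And>w. X w \<Longrightarrow> f w \<in> lp p"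
    and sound: "\<And>w c r. X w \<Longrightarrow> A w (prod_encode (c, r)) \<Longrightarrow> 0 < rat_code r \<and> f w \<in> rat_ball p R c r"
    and complete: "\<And>w d. X w \<Longrightarrow> 0 < d \<Longrightarrow> \<exists>c r. A w (prod_encode (c, r)) \<and> rat_code r < d"
  obtains Up Lo where "sig1 (\<lambda>z. Up (pfst z) (psnd z))" "sig1 (\<lambda>z. Lo (pfst z) (psnd z))"
    "\<And>w u. X w \<Longrightarrow> Up w u \<longleftrightarrow> lp_norm p (f w) < rat_code u"
    "\<And>w u. X w \<Longrightarrow> Lo w u \<longleftrightarrow> rat_code u < lp_norm p (f w)"
proof -
  obtain P where P: "partrec P"
    and P1': "\<forall>c r b s. 0 < rat_code r \<and> P (prod_encode (c, r)) = Some (prod_encode (b, s)) \<longrightarrow>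
         (\<forall>f\<in>rat_ball p R c r. complex_of_real (lp_norm p f) \<in> ball (gauss_code b) (rat_code s))"
    and P2': "\<forall>f\<in>lp p. \<forall>e>0. \<exists>d>0. \<forall>c r. 0 < rat_code r \<and> rat_code r < d \<and> f \<in> rat_ball p R c r \<longrightarrow>
         (\<exists>b s. P (prod_encode (c, r)) = Some (prod_encode (b, s)) \<and>
            ball (gauss_code b) (rat_code s) \<subseteq> ball (complex_of_real (lp_norm p f)) e)"
    using pres unfolding computable_presentation_def by (elim conjE exE) (rule that)
  have P1: "complex_of_real (lp_norm p g) \<in> ball (gauss_code b) (rat_code s)"
    if "0 < rat_code r" "P (prod_encode (c, r)) = Some (prod_encode (b, s))" "g \<in> rat_ball p R c r" for c r b s g
    using P1' that by blast
  have P2: "\<exists>d>0. \<forall>c r. 0 < rat_code r \<and> rat_code r < d \<and> g \<in> rat_ball p R c r \<longrightarrow>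
         (\<exists>b s. P (prod_encode (c, r)) = Some (prod_encode (b, s)) \<and>
            ball (gauss_code b) (rat_code s) \<subseteq> ball (complex_of_real (lp_norm p g)) e)"
    if "g \<in> lp p" "0 < e" for g e
    by (rule mp[OF spec[OF bspec[OF P2' that(1)]] that(2)])
  define Up where "Up w u \<longleftrightarrow> (\<exists>cr bs. A w cr \<and> P cr = Some bs \<and>
    rat_code (pfst (pfst bs)) + rat_code (psnd bs) < rat_code u)" for w u
  define Lo where "Lo w u \<longleftrightarrow> (\<exists>cr bs. A w cr \<and> P cr = Some bs \<and>
    rat_code u < rat_code (pfst (pfst bs)) - rat_code (psnd bs))" for w u
  note rec = rec_intros sig1_comp2[OF A] sig1_comp2[OF partrec_graph_sig1[OF P]]
  have "sig1 (\<lambda>z. Up (pfst z) (psnd z))" "sig1 (\<lambda>z. Lo (pfst z) (psnd z))"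
    unfolding Up_def Lo_def by (intro rec)+
  moreover have "Up w u \<longleftrightarrow> lp_norm p (f w) < rat_code u" "Lo w u \<longleftrightarrow> rat_code u < lp_norm p (f w)"
    if X: "X w" for w u
  proof -
    have bounds: "\<bar>lp_norm p (f w) - rat_code (pfst (pfst bs))\<bar> < rat_code (psnd bs)"
      if "A w cr" "P cr = Some bs" for cr bs
    proof -
      have "A w (prod_encode (pfst cr, psnd cr))" "P (prod_encode (pfst cr, psnd cr)) = Some (prod_encode (pfst bs, psnd bs))"
        using that by simp_all
      from P1[OF _ this(2)] sound[OF X this(1)]
      have "dist (gauss_code (pfst bs)) (complex_of_real (lp_norm p (f w))) < rat_code (psnd bs)" by auto
      moreover have "\<bar>Re (complex_of_real (lp_norm p (f w)) - gauss_code (pfst bs))\<bar>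
          \<le> dist (gauss_code (pfst bs)) (complex_of_real (lp_norm p (f w)))"
        unfolding dist_norm norm_minus_commute[of "gauss_code _"] by (rule abs_Re_le_cmod)
      ultimately show ?thesis by (simp add: gauss_code_eq)
    qed
    have close: "\<exists>cr bs. A w cr \<and> P cr = Some bs \<and>
        \<bar>lp_norm p (f w) - rat_code (pfst (pfst bs))\<bar> + rat_code (psnd bs) \<le> e" if e: "0 < e" for e
    proof -
      obtain d where "0 < d" and d: "\<And>c r. 0 < rat_code r \<Longrightarrow> rat_code r < d \<Longrightarrow> f w \<in> rat_ball p R c r \<Longrightarrow>
         (\<exists>b s. P (prod_encode (c, r)) = Some (prod_encode (b, s)) \<and>
            ball (gauss_code b) (rat_code s) \<subseteq> ball (complex_of_real (lp_norm p (f w))) e)"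
        using P2[OF in_lp[OF X] e] by blast
      obtain c r where cr: "A w (prod_encode (c, r))" "rat_code r < d"
        using complete[OF X \<open>0 < d\<close>] by blast
      with d sound[OF X cr(1)] obtain b s where bs: "P (prod_encode (c, r)) = Some (prod_encode (b, s))"
        and sub: "ball (gauss_code b) (rat_code s) \<subseteq> ball (complex_of_real (lp_norm p (f w))) e" by blast
      \<comment> \<open>An empty ball would be included in any other and say nothing; this one
        contains the norm.\<close>
      have "0 < rat_code s"
        using le_less_trans[OF abs_ge_zero bounds[OF cr(1) bs]] unfolding psnd_encode .
      then have "dist (gauss_code b) (complex_of_real (lp_norm p (f w))) + rat_code s \<le> e"
        using sub unfolding ball_subset_ball_iff by linarith
      moreover have "\<bar>Re (complex_of_real (lp_norm p (f w)) - gauss_code b)\<bar>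
          \<le> dist (gauss_code b) (complex_of_real (lp_norm p (f w)))"
        unfolding dist_norm norm_minus_commute[of "gauss_code _"] by (rule abs_Re_le_cmod)
      ultimately show ?thesis
        using cr(1) bs by (intro exI[of _ "prod_encode (c, r)"] exI[of _ "prod_encode (b, s)"])
          (simp add: gauss_code_eq)
    qed
    show "Up w u \<longleftrightarrow> lp_norm p (f w) < rat_code u"
    proof
      assume "Up w u"
      then obtain cr bs where "A w cr" "P cr = Some bs" "rat_code (pfst (pfst bs)) + rat_code (psnd bs) < rat_code u"
        unfolding Up_def by blast
      with bounds[OF this(1,2)] show "lp_norm p (f w) < rat_code u" by linarith
    next
      assume lt: "lp_norm p (f w) < rat_code u"
      then obtain cr bs where *: "A w cr" "P cr = Some bs"
        "\<bar>lp_norm p (f w) - rat_code (pfst (pfst bs))\<bar> + rat_code (psnd bs) \<le> (rat_code u - lp_norm p (f w)) / 2"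
        using close[of "(rat_code u - lp_norm p (f w)) / 2"] by auto
      have "rat_code (pfst (pfst bs)) + rat_code (psnd bs) < rat_code u"
        using *(3) lt by argo
      with * show "Up w u" unfolding Up_def by blast
    qed
    show "Lo w u \<longleftrightarrow> rat_code u < lp_norm p (f w)"
    proof
      assume "Lo w u"
      then obtain cr bs where "A w cr" "P cr = Some bs" "rat_code u < rat_code (pfst (pfst bs)) - rat_code (psnd bs)"
        unfolding Lo_def by blast
      with bounds[OF this(1,2)] show "rat_code u < lp_norm p (f w)" by linarith
    next
      assume lt: "rat_code u < lp_norm p (f w)"
      then obtain cr bs where *: "A w cr" "P cr = Some bs"
        "\<bar>lp_norm p (f w) - rat_code (pfst (pfst bs))\<bar> + rat_code (psnd bs) \<le> (lp_norm p (f w) - rat_code u) / 2"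
        using close[of "(lp_norm p (f w) - rat_code u) / 2"] by auto
      have "rat_code u < rat_code (pfst (pfst bs)) - rat_code (psnd bs)"
        using *(3) lt by argo
      with * show "Lo w u" unfolding Lo_def by blast
    qed
  qed
  ultimately show thesis by (rule that)
qed

text \<open>A code of \<open>(\<nu>, m, l)\<close> stands for \<open>\<phi>\<close> at \<open>\<nu>\<close> minus the sum of \<open>\<phi>\<close> over the first \<open>m\<close> nodes
  of the list \<open>l\<close>.\<close>

definition rest_vec :: "(nat list \<Rightarrow> nat \<Rightarrow> complex) \<Rightarrow> nat \<Rightarrow> nat \<Rightarrow> complex" where
  "rest_vec \<phi> w = (\<lambda>n. \<phi> (list_decode (pfst w)) n -
      (\<Sum>i<pfst (psnd w). \<phi> (list_decode (cnth (psnd (psnd w)) i)) n))"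

definition rest_dom :: "nat list set \<Rightarrow> nat \<Rightarrow> bool" where
  "rest_dom S w \<longleftrightarrow> list_decode (pfst w) \<in> S \<and>
    (\<forall>i<pfst (psnd w). list_decode (cnth (psnd (psnd w)) i) \<in> S)"

lemma sig1_rest_norm:
  fixes R :: "nat \<Rightarrow> nat \<Rightarrow> complex"
  assumes p: "1 \<le> p" and pres: "computable_presentation p R"
    and map: "computable_map p R S \<phi>" and in_lp: "\<phi> ` S \<subseteq> lp p"
  obtains Up Lo where "sig1 (\<lambda>z. Up (pfst z) (psnd z))" "sig1 (\<lambda>z. Lo (pfst z) (psnd z))"
    "\<And>w u. rest_dom S w \<Longrightarrow> Up w u \<longleftrightarrow> lp_norm p (rest_vec \<phi> w) < rat_code u"
    "\<And>w u. rest_dom S w \<Longrightarrow> Lo w u \<longleftrightarrow> rat_code u < lp_norm p (rest_vec \<phi> w)"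
proof -
  have R: "range R \<subseteq> lp p"
    using pres by (simp add: computable_presentation_def presentation_def)
  obtain F where F: "partrec F"
    and approx: "\<And>\<nu> k. \<nu> \<in> S \<Longrightarrow> \<exists>c. F (prod_encode (list_encode \<nu>, k)) = Some c \<and>
         lp_norm p (\<lambda>n. \<phi> \<nu> n - rat_vec R c n) < 1 / 2 ^ k"
    using map unfolding computable_map_def by blast
  have F_ex: "\<exists>c. F (prod_encode (x, k)) = Some c" if "list_decode x \<in> S" for x k
    using approx[OF that, of k] by auto
  have F_close: "lp_norm p (\<lambda>n. \<phi> (list_decode x) n - rat_vec R c n) < 1 / 2 ^ k"
    if "list_decode x \<in> S" "F (prod_encode (x, k)) = Some c" for x k c
    using approx[OF that(1), of k] that(2) by auto
  \<comment> \<open>\<open>ds\<close> lists approximations of the successive differences: entry 0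
    approximates \<open>\<phi>\<close> at the first node, and each step subtracts one more
    approximation. The \<open>m + 1\<close> errors below \<open>1 / 2 ^ k\<close> add up to less
    than the radius; asking for a radius of at least \<open>(m + 1) / (k + 1)\<close> avoids an
    exponential in the predicate.\<close>
  define A where "A w cr \<longleftrightarrow> (\<exists>k ds. F (prod_encode (pfst w, k)) = Some (cnth ds 0) \<and>
      (\<forall>i<pfst (psnd w). \<exists>c. F (prod_encode (cnth (psnd (psnd w)) i, k)) = Some c \<and>
         vadd (cnth ds (Suc i)) c (cnth ds i)) \<and>
      pfst cr = cnth ds (pfst (psnd w)) \<and>
      real (Suc (pfst (psnd w))) \<le> rat_code (psnd cr) * real (Suc k))" for w cr
  have A: "sig1 (\<lambda>z. A (pfst z) (psnd z))"
    unfolding A_def by (intro rec_intros sig1_comp2[OF partrec_graph_sig1[OF F]])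
  have rest_lp: "rest_vec \<phi> w \<in> lp p" if "rest_dom S w" for w
    unfolding rest_vec_def using that in_lp by (intro lp_diff lp_sum p) (auto simp: rest_dom_def)
  show thesis
  proof (rule sig1_norm_bounds[OF pres A, where X = "rest_dom S" and f = "rest_vec \<phi>"])
    fix w c r assume X: "rest_dom S w" and "A w (prod_encode (c, r))"
    define x where "x = pfst w"
    define m where "m = pfst (psnd w)"
    define l where "l = psnd (psnd w)"
    obtain k ds where d0: "F (prod_encode (x, k)) = Some (cnth ds 0)"
      and dSuc: "\<And>i. i < m \<Longrightarrow> \<exists>c. F (prod_encode (cnth l i, k)) = Some c \<and> vadd (cnth ds (Suc i)) c (cnth ds i)"
      and c: "c = cnth ds m" and r: "real (Suc m) \<le> rat_code r * real (Suc k)"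
      using \<open>A w _\<close> unfolding A_def x_def m_def l_def by auto
    have xS: "list_decode x \<in> S" and lS: "\<And>i. i < m \<Longrightarrow> list_decode (cnth l i) \<in> S"
      using X by (auto simp: rest_dom_def x_def m_def l_def)
    have "0 < rat_code r * real (Suc k)"
      using r by linarith
    then have r_pos: "0 < rat_code r" by (simp add: zero_less_mult_iff)
    have err: "lp_norm p (\<lambda>n. (\<phi> (list_decode x) n - (\<Sum>i<j. \<phi> (list_decode (cnth l i)) n)) - rat_vec R (cnth ds j) n)
        < real (Suc j) / 2 ^ k" if "j \<le> m" for j
      using that
    proof (induction j)
      case 0
      then show ?case using F_close[OF xS d0] by simp
    next
      case (Suc j)
      then have j: "j < m" by simp
      obtain c where c: "F (prod_encode (cnth l j, k)) = Some c" "vadd (cnth ds (Suc j)) c (cnth ds j)"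
        using dSuc[OF j] by blast
      let ?f = "\<lambda>n. (\<phi> (list_decode x) n - (\<Sum>i<j. \<phi> (list_decode (cnth l i)) n)) - rat_vec R (cnth ds j) n"
      let ?g = "\<lambda>n. \<phi> (list_decode (cnth l j)) n - rat_vec R c n"
      have "?f \<in> lp p" "?g \<in> lp p"
        using xS lS j in_lp by (auto intro!: lp_diff lp_sum p rat_vec_in_lp[OF p R])
      then have "lp_norm p (\<lambda>n. ?f n - ?g n) \<le> lp_norm p ?f + lp_norm p ?g"
        by (intro lp_norm_diff p)
      also have "\<dots> < real (Suc j) / 2 ^ k + 1 / 2 ^ k"
        using Suc F_close[OF lS[OF j] c(1)] by (intro add_strict_mono) auto
      also have "\<dots> = real (Suc (Suc j)) / 2 ^ k"
        by (simp add: add_divide_distrib)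
      also have "(\<lambda>n. ?f n - ?g n) = (\<lambda>n. (\<phi> (list_decode x) n - (\<Sum>i<Suc j. \<phi> (list_decode (cnth l i)) n))
          - rat_vec R (cnth ds (Suc j)) n)"
        unfolding vadd_rat_vec[OF c(2)] by (simp add: algebra_simps)
      finally show ?case .
    qed
    have "real (Suc k) \<le> 2 ^ k"
      using of_nat_mono[OF Suc_leI[OF less_exp[of k]], where 'a = real] by simp
    then have "real (Suc m) / 2 ^ k \<le> real (Suc m) / real (Suc k)"
      by (intro divide_left_mono) auto
    also have "\<dots> \<le> rat_code r"
      using r by (simp add: pos_divide_le_eq)
    finally have "lp_norm p (\<lambda>n. rest_vec \<phi> w n - rat_vec R c n) < rat_code r"
      using err[of m] by (simp add: rest_vec_def x_def m_def l_def c)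
    then show "0 < rat_code r \<and> rest_vec \<phi> w \<in> rat_ball p R c r"
      using r_pos rest_lp[OF X] by (simp add: rat_ball_def)
  next
    fix w and d :: real assume X: "rest_dom S w" and "0 < d"
    define m where "m = pfst (psnd w)"
    define l where "l = psnd (psnd w)"
    obtain r where r: "0 < rat_code r" "rat_code r < d"
      using ex_rat_code_between[OF \<open>0 < d\<close>] by blast
    obtain k where k: "real (Suc m) / rat_code r < real k"
      using reals_Archimedean2 by blast
    have k': "real (Suc m) \<le> rat_code r * real (Suc k)"
    proof -
      have "real (Suc m) < real k * rat_code r"
        using k unfolding pos_divide_less_eq[OF r(1)] .
      moreover have "rat_code r * real (Suc k) = real k * rat_code r + rat_code r"
        by (simp add: algebra_simps)
      ultimately show ?thesis using r(1) by linarith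
    qed
    obtain c0 where c0: "F (prod_encode (pfst w, k)) = Some c0"
      using F_ex[of "pfst w" k] X by (auto simp: rest_dom_def)
    have "\<forall>i. \<exists>c. i < m \<longrightarrow> F (prod_encode (cnth l i, k)) = Some c"
      using F_ex X by (auto simp: rest_dom_def m_def l_def)
    then obtain c where c: "\<And>i. i < m \<Longrightarrow> F (prod_encode (cnth l i, k)) = Some (c i)" by metis
    obtain g where g: "\<And>c e. vadd (g c e) c e" using ex_vadd by metis
    \<comment> \<open>\<open>D i\<close> is a code of the approximation after \<open>i\<close>
      subtractions; these codes become the entries of the witness \<open>ds\<close>.\<close>
    define D where "D = rec_nat c0 (\<lambda>i e. g (c i) e)"
    obtain ds where ds: "\<And>i. i < Suc m \<Longrightarrow> cnth ds i = D i"
      using ex_cnth[of "Suc m" D] by blast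
    have "F (prod_encode (pfst w, k)) = Some (cnth ds 0)"
      using c0 ds[of 0] by (simp add: D_def)
    moreover have "\<forall>i<m. \<exists>c. F (prod_encode (cnth l i, k)) = Some c \<and> vadd (cnth ds (Suc i)) c (cnth ds i)"
      using c g ds by (simp add: D_def)
    ultimately have "A w (prod_encode (cnth ds m, r))"
      unfolding A_def m_def[symmetric] l_def[symmetric] pfst_encode psnd_encode using k' by blast
    then show "\<exists>c r. A w (prod_encode (c, r)) \<and> rat_code r < d"
      using r(2) by blast
  qed (use rest_lp that in blast)+
qed

section \<open>The selected child\<close>

lemma semidecidable_good_children:
  assumes p: "1 \<le> p" and pres: "computable_presentation p R"
    and dis: "disintegration p S \<phi>" and map: "computable_map p R S \<phi>"
    and eps_pos: "\<forall>\<nu>\<in>S. 0 < \<epsilon> \<nu>" and eps: "lower_semicomputable S \<epsilon>"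
  obtains Q where "sig1 (\<lambda>z. Q (pfst z) (psnd z))"
    "\<And>x y. Q x y \<Longrightarrow> list_decode y \<in> children S (list_decode x)"
    "\<And>x y \<mu>. Q x y \<Longrightarrow> \<mu> \<in> children S (list_decode x) \<Longrightarrow>
      lp_norm p (\<phi> \<mu>) powr p - lp_norm p (\<phi> (list_decode y)) powr p < \<epsilon> (list_decode x)"
    "\<And>x. list_decode x \<in> S \<Longrightarrow> \<not> terminal S (list_decode x) \<Longrightarrow> \<exists>y. Q x y"
proof -
  interpret lp_disintegration p S \<phi> using p dis by unfold_locales
  have S: "sig1 (\<lambda>x. list_decode x \<in> S)"
  proof -
    have "list_decode x \<in> S \<longleftrightarrow> x \<in> list_encode ` S" for x
      by (metis image_iff list_decode_inverse list_encode_inverse)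
    then show ?thesis
      using map ce_set_sig1 unfolding computable_map_def by simp
  qed
  have Eps: "sig1 (\<lambda>z. list_decode (pfst z) \<in> S \<and> rat_code (psnd z) < \<epsilon> (list_decode (pfst z)))"
  proof -
    have "z \<in> {prod_encode (list_encode \<nu>, c) | \<nu> c. \<nu> \<in> S \<and> rat_code c < \<epsilon> \<nu>} \<longleftrightarrow>
        list_decode (pfst z) \<in> S \<and> rat_code (psnd z) < \<epsilon> (list_decode (pfst z))" for z
      by (auto intro!: exI[of _ "list_decode (pfst z)"] exI[of _ "psnd z"])
    then show ?thesis
      using ce_set_sig1[OF eps[unfolded lower_semicomputable_def]] by simp
  qed
  have "\<phi> ` S \<subseteq> lp p" using in_lp by blast
  from sig1_rest_norm[OF p pres map this] obtain Up Lo
    where Up: "sig1 (\<lambda>z. Up (pfst z) (psnd z))" and Lo: "sig1 (\<lambda>z. Lo (pfst z) (psnd z))"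
      and Up_iff: "\<And>w u. rest_dom S w \<Longrightarrow> Up w u \<longleftrightarrow> lp_norm p (rest_vec \<phi> w) < rat_code u"
      and Lo_iff: "\<And>w u. rest_dom S w \<Longrightarrow> Lo w u \<longleftrightarrow> rat_code u < lp_norm p (rest_vec \<phi> w)"
    by blast
  \<comment> \<open>With zero subtracted nodes, \<open>rest_vec\<close> at this code is
    \<open>\<phi>\<close> itself, so the bounds for differences also cover single nodes.\<close>
  define node where "node y = prod_encode (y, prod_encode (0, 0))" for y
  have Up_node: "Up (node y) u \<longleftrightarrow> lp_norm p (\<phi> (list_decode y)) < rat_code u"
    and Lo_node: "Lo (node y) u \<longleftrightarrow> rat_code u < lp_norm p (\<phi> (list_decode y))"
    if "list_decode y \<in> S" for y u
    using Up_iff[of "node y"] Lo_iff[of "node y"] that by (simp_all add: node_def rest_vec_def rest_dom_def)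
  \<comment> \<open>\<open>K\<close> is a Lipschitz constant of the \<open>p\<close>-th power on the range of the norms.\<close>
  obtain K :: nat where K: "p * lp_norm p (\<phi> []) powr (p - 1) < real K"
    using reals_Archimedean2 by blast
  have K_nonneg: "0 \<le> p * lp_norm p (\<phi> []) powr (p - 1)" using p by simp
  with K have K_pos: "0 < real K" by linarith
  \<comment> \<open>The first conjunct is kept as one unit: lower semicomputability enumerates
    rationals below \<open>\<epsilon>\<close> only together with membership in \<open>S\<close>, and
    says nothing about \<open>\<epsilon>\<close> off \<open>S\<close>.\<close>
  define Q where "Q x y \<longleftrightarrow> (\<exists>q t u m l.
    (list_decode x \<in> S \<and> rat_code q < \<epsilon> (list_decode x)) \<and>
    real K * (rat_code u - rat_code t) \<le> rat_code q \<and>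
    list_decode y \<in> S \<and> (\<exists>k. list_decode y = list_decode x @ [k]) \<and> Lo (node y) t \<and>
    (\<forall>i<m. list_decode (cnth l i) \<in> S \<and> (\<exists>k. list_decode (cnth l i) = list_decode x @ [k]) \<and> Up (node (cnth l i)) u) \<and>
    Up (prod_encode (x, prod_encode (m, l))) u)" for x y
  have Eps': "sig1 (\<lambda>x. list_decode (f x) \<in> S \<and> rat_code (g x) < \<epsilon> (list_decode (f x)))"
    if "recf f" "recf g" for f g
    using sig1_comp[OF Eps recf_pair[OF that]] by simp
  have "sig1 (\<lambda>z. Q (pfst z) (psnd z))"
    unfolding Q_def node_def
    by (intro Eps' sig1_comp[OF S] sig1_comp2[OF Up] sig1_comp2[OF Lo] rec_intros)
  moreover have child: "list_decode y \<in> children S (list_decode x)" if "Q x y" for x y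
    using that unfolding Q_def children_def by auto
  moreover have "lp_norm p (\<phi> \<mu>) powr p - lp_norm p (\<phi> (list_decode y)) powr p < \<epsilon> (list_decode x)"
    if Q: "Q x y" and \<mu>: "\<mu> \<in> children S (list_decode x)" for x y \<mu>
  proof -
    obtain q t u m l where q: "rat_code q < \<epsilon> (list_decode x)" "real K * (rat_code u - rat_code t) \<le> rat_code q"
      and x: "list_decode x \<in> S" and y: "list_decode y \<in> S" "Lo (node y) t"
      and l: "\<And>i. i < m \<Longrightarrow> list_decode (cnth l i) \<in> S \<and> (\<exists>k. list_decode (cnth l i) = list_decode x @ [k]) \<and> Up (node (cnth l i)) u"
      and rest: "Up (prod_encode (x, prod_encode (m, l))) u"
      using Q unfolding Q_def by blast
    have lc: "list_decode (cnth l i) \<in> children S (list_decode x)" if "i < m" for i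
      using l[OF that] by (auto simp: children_def)
    have u: "lp_norm p (\<phi> \<mu>) < rat_code u"
    proof (cases "\<exists>i<m. list_decode (cnth l i) = \<mu>")
      case True
      then show ?thesis using l Up_node by blast
    next
      case False
      then have "lp_norm p (\<phi> \<mu>) \<le> lp_norm p (\<lambda>n. \<phi> (list_decode x) n - (\<Sum>i<m. \<phi> (list_decode (cnth l i)) n))"
        using lc by (intro child_norm_le_rest[OF \<mu>]) auto
      also have "\<dots> < rat_code u"
        using rest Up_iff[of "prod_encode (x, prod_encode (m, l))" u] x l
        by (simp add: rest_vec_def rest_dom_def)
      finally show ?thesis .
    qed
    have t: "rat_code t < lp_norm p (\<phi> (list_decode y))"
      using y Lo_node by blast
    have eps: "0 < \<epsilon> (list_decode x)" using eps_pos x by blast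
    show ?thesis
    \<comment> \<open>If \<open>\<mu>\<close> has the larger norm, \<open>u - t\<close> exceeds the
      difference of the norms and \<open>K\<close> carries this over to the powers. Otherwise the
      difference of the powers is at most 0 and positivity of \<open>\<epsilon>\<close>
      suffices.\<close>
    proof (cases "lp_norm p (\<phi> (list_decode y)) \<le> lp_norm p (\<phi> \<mu>)")
      case True
      have "lp_norm p (\<phi> \<mu>) powr p - lp_norm p (\<phi> (list_decode y)) powr p
          \<le> p * lp_norm p (\<phi> []) powr (p - 1) * (lp_norm p (\<phi> \<mu>) - lp_norm p (\<phi> (list_decode y)))"
        using True \<mu> children_subset norm_le_root by (intro powr_diff_le p) auto
      also have "\<dots> \<le> real K * (rat_code u - rat_code t)"
        using K K_nonneg u t True by (intro mult_mono) linarith+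
      also have "\<dots> < \<epsilon> (list_decode x)" using q by linarith
      finally show ?thesis .
    next
      case False
      then have "lp_norm p (\<phi> \<mu>) powr p \<le> lp_norm p (\<phi> (list_decode y)) powr p"
        using p by (intro powr_mono2) auto
      then show ?thesis using eps by linarith
    qed
  qed
  moreover have "\<exists>y. Q x y" if x: "list_decode x \<in> S" and nt: "\<not> terminal S (list_decode x)" for x
  proof -
    obtain \<mu> where \<mu>: "\<mu> \<in> children S (list_decode x)"
      and max: "\<And>\<tau>. \<tau> \<in> children S (list_decode x) \<Longrightarrow> lp_norm p (\<phi> \<tau>) \<le> lp_norm p (\<phi> \<mu>)"
      using ex_max_child[OF nt] by blast
    define a where "a = lp_norm p (\<phi> \<mu>)"
    have a: "0 < a" unfolding a_def using norm_pos \<mu> children_subset by blast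
    obtain q where q: "0 < rat_code q" "rat_code q < \<epsilon> (list_decode x)"
      using ex_rat_code_between eps_pos x by blast
    \<comment> \<open>Both \<open>u\<close> and \<open>t\<close> are chosen within
      \<open>\<delta>\<close> of the largest norm \<open>a\<close>, so \<open>K\<close> times their
      distance is at most \<open>K * (2 * \<delta>) = q\<close>.\<close>
    define \<delta> where "\<delta> = rat_code q / (2 * real K)"
    have \<delta>: "0 < \<delta>" unfolding \<delta>_def using q(1) K_pos by (intro divide_pos_pos) auto
    obtain u where u: "a < rat_code u" "rat_code u < a + \<delta>"
      using ex_rat_code_between[of a "a + \<delta>"] \<delta> by auto
    obtain t where t: "a - \<delta> < rat_code t" "rat_code t < a"
      using ex_rat_code_between[of "a - \<delta>" a] \<delta> by auto
    have "real K * (rat_code u - rat_code t) \<le> real K * (2 * \<delta>)"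
      using u t K_pos by (intro mult_left_mono) auto
    also have "\<dots> = rat_code q" unfolding \<delta>_def using K_pos by simp
    finally have qut: "real K * (rat_code u - rat_code t) \<le> rat_code q" .
    obtain m :: nat and c where c: "\<And>i. i < m \<Longrightarrow> c i \<in> children S (list_decode x)"
      and rest: "lp_norm p (\<lambda>n. \<phi> (list_decode x) n - (\<Sum>i<m. \<phi> (c i) n)) < a"
      using rest_small[OF \<mu> a] by blast
    obtain l where l: "\<And>i. i < m \<Longrightarrow> cnth l i = list_encode (c i)"
      using ex_cnth[of m "\<lambda>i. list_encode (c i)"] by blast
    have cS: "c i \<in> S" "\<exists>k. c i = list_decode x @ [k]" "lp_norm p (\<phi> (c i)) < rat_code u" if "i < m" for i
      using c[OF that] max[of "c i"] u(1) by (auto simp: children_def a_def)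
    have \<mu>S: "\<mu> \<in> S" "\<exists>k. \<mu> = list_decode x @ [k]"
      using \<mu> by (auto simp: children_def)
    have "Lo (node (list_encode \<mu>)) t"
      using Lo_node \<mu>S t(2) by (simp add: a_def)
    moreover have "Up (node (cnth l i)) u" if "i < m" for i
      using Up_node cS[OF that] l[OF that] by simp
    moreover have "Up (prod_encode (x, prod_encode (m, l))) u"
      using Up_iff[of "prod_encode (x, prod_encode (m, l))" u] x cS(1) l rest u(1)
      by (simp add: rest_vec_def rest_dom_def)
    ultimately have "Q x (list_encode \<mu>)"
      unfolding Q_def using x q(2) qut \<mu>S cS(1,2) l
      by (intro exI[of _ q] exI[of _ t] exI[of _ u] exI[of _ m] exI[of _ l]) simp
    then show ?thesis by blast
  qed
  ultimately show thesis by (rule that)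
qed

theorem theorem3p3:
  fixes p :: real and R :: "nat \<Rightarrow> nat \<Rightarrow> complex"
    and S :: "nat list set" and \<phi> :: "nat list \<Rightarrow> nat \<Rightarrow> complex" and \<epsilon> :: "nat list \<Rightarrow> real"
  assumes "1 \<le> p" and "computable_real p"
    and "computable_presentation p R"
    and "disintegration p S \<phi>" and "computable_map p R S \<phi>"
    and "\<forall>\<nu>\<in>S. 0 < \<epsilon> \<nu>" and "lower_semicomputable S \<epsilon>"
  shows "\<exists>C :: nat \<Rightarrow> nat list set.
    (\<forall>n. C n \<noteq> {}) \<and> disjoint_family C \<and> (\<Union>n. C n) = S \<and>
    (\<forall>n. is_chain (C n)) \<and> uniformly_computable S C \<and>
    (\<forall>n. \<forall>\<nu>\<in>C n. \<not> terminal S \<nu> \<longrightarrow>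
      (\<exists>\<nu>'\<in>children S \<nu> \<inter> C n. \<exists>\<mu>.
         is_arg_max (\<lambda>\<mu>. lp_norm p (\<phi> \<mu>) powr p) (\<lambda>\<mu>. \<mu> \<in> children S \<nu>) \<mu> \<and>
         lp_norm p (\<phi> \<mu>) powr p - lp_norm p (\<phi> \<nu>') powr p < \<epsilon> \<nu>))"
proof -
  interpret lp_disintegration p S \<phi> using assms by unfold_locales
  obtain Q where Q: "sig1 (\<lambda>z. Q (pfst z) (psnd z))"
    and Q_child: "\<And>x y. Q x y \<Longrightarrow> list_decode y \<in> children S (list_decode x)"
    and Q_good: "\<And>x y \<mu>. Q x y \<Longrightarrow> \<mu> \<in> children S (list_decode x) \<Longrightarrow>
      lp_norm p (\<phi> \<mu>) powr p - lp_norm p (\<phi> (list_decode y)) powr p < \<epsilon> (list_decode x)"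
    and Q_ex: "\<And>x. list_decode x \<in> S \<Longrightarrow> \<not> terminal S (list_decode x) \<Longrightarrow> \<exists>y. Q x y"
    using semidecidable_good_children[OF assms(1,3-7)] by blast
  obtain h where h: "partrec h" and hQ: "\<And>x y. h x = Some y \<Longrightarrow> Q x y" and Qh: "\<And>x y. Q x y \<Longrightarrow> h x \<noteq> None"
    using sig1_uniformize[OF Q] by blast
  define r where "r = {(\<nu>, \<tau>). h (list_encode \<nu>) = Some (list_encode \<tau>)}"
  have r_code: "(list_decode x, list_decode y) \<in> r \<longleftrightarrow> h x = Some y" for x y
    by (simp add: r_def)
  have rQ: "Q (list_encode \<nu>) (list_encode \<tau>)" if "(\<nu>, \<tau>) \<in> r" for \<nu> \<tau>
    using that hQ by (simp add: r_def)
  interpret child_selection S r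
  proof
    show "is_tree S" using assms(4) by (simp add: disintegration_def)
    show "\<exists>\<sigma>\<in>children S \<nu>. \<sigma> \<noteq> \<tau>" if "\<tau> \<in> children S \<nu>" for \<nu> \<tau> using that by (rule ex_other_child)
    show "\<tau> \<in> children S \<nu>" if "(\<nu>, \<tau>) \<in> r" for \<nu> \<tau>
      using Q_child[OF rQ[OF that]] by simp
    show "single_valued r" by (auto simp: single_valued_def r_def list_encode_eq)
    show "\<exists>\<tau>. (\<nu>, \<tau>) \<in> r" if "\<nu> \<in> S" "\<not> terminal S \<nu>" for \<nu>
    proof -
      have "\<exists>y. Q (list_encode \<nu>) y"
        by (rule Q_ex) (simp_all add: that)
      then obtain z where "h (list_encode \<nu>) = Some z" using Qh by blast
      then show ?thesis by (intro exI[of _ "list_decode z"]) (simp add: r_def)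
    qed
  qed (rule infinite_tree)
  have S: "sig1 (\<lambda>x. x \<in> list_encode ` S)"
    using assms(5) ce_set_sig1 unfolding computable_map_def by blast
  have bij: "bij list_decode"
    by (rule bij_list_decode)
  have r_sig1: "sig1 (\<lambda>z. (list_decode (pfst z), list_decode (psnd z)) \<in> r)"
    unfolding r_code by (rule partrec_graph_sig1[OF h])
  define Rt where "Rt = list_encode ` roots"
  have Rt_iff: "x \<in> Rt \<longleftrightarrow> list_decode x \<in> roots" for x
    unfolding Rt_def by (metis image_iff list_decode_inverse list_encode_inverse)
  \<comment> \<open>The description of \<open>roots_eq\<close> in terms of codes; 0 is the code of
    the empty sequence.\<close>
  have "sig1 (\<lambda>x. x \<in> list_encode ` S \<and> (x = 0 \<or>
      (\<exists>s t. (list_decode s, list_decode t) \<in> r \<and> (\<exists>k. list_decode x = list_decode s @ [k]) \<and> x \<noteq> t)))"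
    by (intro sig1_comp[OF S] sig1_comp2[OF r_sig1] rec_intros)
  moreover have "x \<in> Rt \<longleftrightarrow> x \<in> list_encode ` S \<and> (x = 0 \<or>
      (\<exists>s t. (list_decode s, list_decode t) \<in> r \<and> (\<exists>k. list_decode x = list_decode s @ [k]) \<and> x \<noteq> t))" for x
  proof -
    have "list_decode x = [] \<longleftrightarrow> x = 0"
      by (metis list_decode.simps(1) list_decode_inverse)
    moreover have "(\<exists>\<sigma> \<tau>. (\<sigma>, \<tau>) \<in> r \<and> (\<exists>k. list_decode x = \<sigma> @ [k]) \<and> list_decode x \<noteq> \<tau>) \<longleftrightarrow>
        (\<exists>s t. (list_decode s, list_decode t) \<in> r \<and> (\<exists>k. list_decode x = list_decode s @ [k]) \<and> x \<noteq> t)"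
      by (metis list_decode_inverse list_encode_inverse)
    moreover have "list_decode x \<in> S \<longleftrightarrow> x \<in> list_encode ` S"
      by (metis image_iff list_decode_inverse list_encode_inverse)
    ultimately show ?thesis
      unfolding Rt_iff roots_eq by simp
  qed
  ultimately have "sig1 (\<lambda>x. x \<in> Rt)" by simp
  moreover have "infinite Rt"
    unfolding Rt_def using infinite_roots inj_list_encode finite_imageD by blast
  ultimately obtain e where e: "recf e" "inj e" "range e = Rt"
    by (rule sig1_infinite_enumeration)
  define C where "C n = r\<^sup>* `` {list_decode (e n)}" for n
  have e_root: "list_decode (e n) \<in> roots" for n
    using e(3) Rt_iff by blast
  have C_disjoint: "n = n'" if "\<nu> \<in> C n" "\<nu> \<in> C n'" for n n' \<nu>
  proof -
    have "list_decode (e n) = list_decode (e n')"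
      using that e_root by (auto simp: C_def intro: root_unique)
    then show ?thesis using e(2) bij by (metis bij_is_inj injD)
  qed
  have C_Un: "(\<Union>n. C n) = S"
  proof (intro equalityI subsetI)
    fix \<nu> assume "\<nu> \<in> (\<Union>n. C n)"
    then show "\<nu> \<in> S"
      using rtrancl_tree e_root by (auto simp: C_def roots_def)
  next
    fix \<nu> assume "\<nu> \<in> S"
    then obtain \<rho> where \<rho>: "\<rho> \<in> roots" "(\<rho>, \<nu>) \<in> r\<^sup>*" using ex_root by blast
    then have "list_encode \<rho> \<in> range e" unfolding e(3) Rt_def by blast
    then obtain n where "e n = list_encode \<rho>" by auto
    with \<rho> have "\<nu> \<in> C n" by (simp add: C_def)
    then show "\<nu> \<in> (\<Union>n. C n)" by blast
  qed
  then have in_S: "\<nu> \<in> S \<longleftrightarrow> (\<exists>n. \<nu> \<in> C n)" for \<nu> by auto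
  \<comment> \<open>As the chains partition \<open>S\<close>, a node is outside of one chain iff it is found in another one.\<close>
  have C_sig1: "sig1 (\<lambda>x. list_decode (g x) \<in> C (f x))" if "recf f" "recf g" for f g
    using sig1_comp2[OF sig1_rtrancl[OF r_sig1 bij] recf_comp[OF e(1) that(1)] that(2)]
    by (simp add: C_def)
  define D where "D z = (if list_decode (psnd z) \<in> S
    then Some (of_bool (list_decode (psnd z) \<in> C (pfst z)) :: nat) else None)" for z
  have "partrec D"
  proof (rule sig1_graph_partrec)
    have "sig1 (\<lambda>z. (list_decode (psnd (pfst z)) \<in> C (pfst (pfst z)) \<and> psnd z = 1) \<or>
        (\<exists>n. n \<noteq> pfst (pfst z) \<and> list_decode (psnd (pfst z)) \<in> C n) \<and> psnd z = 0)"
      by (intro C_sig1 rec_intros)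
    moreover have "D z = Some v \<longleftrightarrow> (list_decode (psnd z) \<in> C (pfst z) \<and> v = 1) \<or>
        (\<exists>n. n \<noteq> pfst z \<and> list_decode (psnd z) \<in> C n) \<and> v = 0" for z v
    proof -
      have "(\<exists>n'. n' \<noteq> n \<and> \<nu> \<in> C n') \<longleftrightarrow> \<nu> \<in> S \<and> \<nu> \<notin> C n" for n \<nu>
        using in_S C_disjoint by metis
      moreover have "\<nu> \<in> C n \<Longrightarrow> \<nu> \<in> S" for n \<nu>
        using in_S by blast
      ultimately show ?thesis by (auto simp: D_def)
    qed
    ultimately show "sig1 (\<lambda>z. D (pfst z) = Some (psnd z))" by simp
  qed
  then have unif: "uniformly_computable S C"
    unfolding uniformly_computable_def by (intro exI[of _ D]) (simp add: D_def)
  have good: "\<exists>\<nu>'\<in>children S \<nu> \<inter> C n. \<exists>\<mu>.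
         is_arg_max (\<lambda>\<mu>. lp_norm p (\<phi> \<mu>) powr p) (\<lambda>\<mu>. \<mu> \<in> children S \<nu>) \<mu> \<and>
         lp_norm p (\<phi> \<mu>) powr p - lp_norm p (\<phi> \<nu>') powr p < \<epsilon> \<nu>"
    if \<nu>: "\<nu> \<in> C n" "\<not> terminal S \<nu>" for n \<nu>
  proof -
    have "\<nu> \<in> S" using \<nu>(1) C_Un by blast
    then obtain \<tau> where \<tau>: "(\<nu>, \<tau>) \<in> r" using sel_ex \<nu>(2) by blast
    then have "\<tau> \<in> C n"
      using \<nu>(1) by (auto simp: C_def intro: rtrancl_into_rtrancl)
    moreover obtain \<mu> where \<mu>: "\<mu> \<in> children S \<nu>"
      "\<And>\<tau>. \<tau> \<in> children S \<nu> \<Longrightarrow> lp_norm p (\<phi> \<tau>) \<le> lp_norm p (\<phi> \<mu>)"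
      using ex_max_child[OF \<nu>(2)] by blast
    have "is_arg_max (\<lambda>\<mu>. lp_norm p (\<phi> \<mu>) powr p) (\<lambda>\<mu>. \<mu> \<in> children S \<nu>) \<mu>"
      unfolding is_arg_max_def not_less using \<mu> p1 by (auto simp: not_less intro: powr_mono2)
    moreover have "lp_norm p (\<phi> \<mu>) powr p - lp_norm p (\<phi> \<tau>) powr p < \<epsilon> \<nu>"
      using Q_good[OF rQ[OF \<tau>]] \<mu>(1) by simp
    ultimately show ?thesis using sel_child[OF \<tau>] by blast
  qed
  have "\<forall>n. C n \<noteq> {}" "\<forall>n. is_chain (C n)"
    using chain by (auto simp: C_def)
  moreover have "disjoint_family C"
    using C_disjoint by (auto simp: disjoint_family_on_def)
  ultimately show ?thesis
    using C_Un unif good by (intro exI[of _ C]) blast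
qed

end
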